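(* Let $\mathcal{T}$ be a binary tree with leaves $\mathcal{L}=\{1,\dots,n\}$, let $V_1,\dots,V_n$ be finite-dimensional complex vector spaces attached to the leaves, let $r\in\mathbb{N}$ and let $f:\mathcal{E}(\mathcal{T})\to\mathbb{N}$ be the constant function equal to $r$. Let $\mathcal{A}\subset\mathcal{L}$. Then the flattening rank with respect to $\mathcal{A}$ of a generic tensor $t\in\mathrm{TNS}(\mathcal{T},r)$ equals \[ \dim\Big(\big(\textstyle\bigotimes_{l\in\mathcal{A}}V_l\big)^*\lrcorner\, t\Big)= r^{\mathrm{minmono}|\mathcal{T},\mathcal{A}|}. \]
   Context: A binary tree here is an (unrooted) tree all of whose non-leaf vertices have degree 3. For an edge $e$, removing $e$ splits $\mathcal{T}$ into two trees; $\overleftarrow{e}$ denotes the set of leaves of one of them. For $B\subset\mathcal{L}$ and $t\in V_1\otimes\dots\otimes V_n$, $(\bigotimes_{l\in B}V_l)^*\lrcorner\, t\subset\bigotimes_{l\notin B}V_l$ is the image of the contraction map induced by $t$; its dimension is the flattening rank of $t$ with respect to $B$. $\mathrm{TNS}(\mathcal{T},r)=\{t : \dim((\bigotimes_{l\in\overleftarrow{e}}V_l)^*\lrcorner\, t)\le r\text{ for all edges } e\}$. A monochromatic cut for $(\mathcal{T},\mathcal{A})$ is a set of edges whose removal yields a forest in which every tree has all its leaves in $\mathcal{A}$ or all its leaves outside $\mathcal{A}$; $\mathrm{minmono}|\mathcal{T},\mathcal{A}|$ is the minimal size of such a cut. "Generic" means for all $t$ in a dense Zariski-open subset of $\mathr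m{TNS}(\mathcal{T},r)$.
   Formalization: The formal theorem additionally assumes r ≥ 1 and dim V_l ≥ r for every leaf l; without these the claim fails, e.g. for one edge with two one-dimensional leaves, r = 2 and A one leaf, or for r = 0 and A empty. *)

theory Defs
  imports "HOL-Analysis.Analysis" "HOL-Library.Function_Algebras"
begin

section \<open>Binary trees\<close>

text \<open>
  Undirected simple graphs, given by a vertex set \<open>W\<close> and a set \<open>E\<close> of two-element edges.
  (The predicate \<open>tree\<close> of the AFP entry Graph-Theory excludes directed cycles only, so it is not
  the notion of an unrooted tree.)
\<close>

definition simple_graph :: "'v set \<Rightarrow> 'v set set \<Rightarrow> bool" where
  "simple_graph W E \<longleftrightarrow>
     finite W \<and> E \<subseteq> {e. \<exists>u v. e = {u, v} \<and> u \<in> W \<and> v \<in> W \<and> u \<noteq> v}"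

definition component_of :: "'v set set \<Rightarrow> 'v \<Rightarrow> 'v set" where
  "component_of E v = {w. (v, w) \<in> {(x, y). {x, y} \<in> E}\<^sup>*}"

definition connected_graph :: "'v set \<Rightarrow> 'v set set \<Rightarrow> bool" where
  "connected_graph W E \<longleftrightarrow> W \<noteq> {} \<and> (\<forall>u\<in>W. \<forall>v\<in>W. v \<in> component_of E u)"

definition graph_cycle :: "'v set set \<Rightarrow> 'v list \<Rightarrow> bool" where
  "graph_cycle E p \<longleftrightarrow> length p \<ge> 3 \<and> distinct p \<and>
     (\<forall>i<length p. {p ! i, p ! (Suc i mod length p)} \<in> E)"

definition unrooted_tree :: "'v set \<Rightarrow> 'v set set \<Rightarrow> bool" where
  "unrooted_tree W E \<longleftrightarrow>
     simple_graph W E \<and> connected_graph W E \<and> \<not> (\<exists>p. graph_cycle E p)"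

definition vertex_degree :: "'v set set \<Rightarrow> 'v \<Rightarrow> nat" where
  "vertex_degree E v = card {e \<in> E. v \<in> e}"

text \<open>Degree at most 1 rather than exactly 1: the one-vertex tree has its vertex as only leaf.\<close>

definition leaves :: "'v set \<Rightarrow> 'v set set \<Rightarrow> 'v set" where
  "leaves W E = {v \<in> W. vertex_degree E v \<le> 1}"

definition binary_tree :: "'v set \<Rightarrow> 'v set set \<Rightarrow> bool" where
  "binary_tree W E \<longleftrightarrow>
     unrooted_tree W E \<and> (\<forall>v \<in> W - leaves W E. vertex_degree E v = 3)"

section \<open>Monochromatic cuts\<close>

text \<open>
  The leaves of a tree of the forest are those of its vertices that are leaves of the original
  tree; vertices whose degree drops to 1 because edges were removed do not count.
\<close>

definition monochromatic_cut :: "'v set \<Rightarrow> 'v set set \<Rightarrow> 'v set \<Rightarrow> 'v set set \<Rightarrow> bool" where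
  "monochromatic_cut W E A C \<longleftrightarrow> C \<subseteq> E \<and>
     (\<forall>v\<in>W. component_of (E - C) v \<inter> leaves W E \<subseteq> A \<or>
             component_of (E - C) v \<inter> leaves W E \<inter> A = {})"

definition minmono :: "'v set \<Rightarrow> 'v set set \<Rightarrow> 'v set \<Rightarrow> nat" where
  "minmono W E A = (LEAST k. \<exists>C. monochromatic_cut W E A C \<and> card C = k)"

section \<open>Tensors and flattening ranks\<close>

definition cscale :: "complex \<Rightarrow> ('i \<Rightarrow> complex) \<Rightarrow> 'i \<Rightarrow> complex" where
  "cscale c x = (\<lambda>i. c * x i)"

lemma vector_space_cscale: "vector_space (cscale :: complex \<Rightarrow> ('i \<Rightarrow> complex) \<Rightarrow> _)"
  by unfold_locales (auto simp: cscale_def plus_fun_def algebra_simps)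

text \<open>
  The vector space at the leaf \<open>l\<close> is \<open>\<complex>\<close> to the power \<open>d l\<close>. The tensor product over a
  finite set \<open>B\<close> of leaves then consists of the arrays indexed by the functions choosing an index
  below \<open>d l\<close> for each \<open>l \<in> B\<close>; arrays are extended by 0 to all functions of type \<open>'v \<Rightarrow> nat\<close>.
\<close>

definition multi_index :: "('v \<Rightarrow> nat) \<Rightarrow> 'v set \<Rightarrow> ('v \<Rightarrow> nat) set" where
  "multi_index d B = (\<Pi>\<^sub>E l\<in>B. {..<d l})"

type_synonym 'v tensor = "('v \<Rightarrow> nat) \<Rightarrow> complex"

definition tensor_space :: "('v \<Rightarrow> nat) \<Rightarrow> 'v set \<Rightarrow> 'v tensor set" where
  "tensor_space d B = {t. \<forall>i. i \<notin> multi_index d B \<longrightarrow> t i = 0}"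

text \<open>The dual of a subspace \<open>S\<close>; the values of a functional outside \<open>S\<close> are irrelevant.\<close>

definition linear_functionals :: "('i \<Rightarrow> complex) set \<Rightarrow> (('i \<Rightarrow> complex) \<Rightarrow> complex) set" where
  "linear_functionals S = {\<phi>. (\<forall>x\<in>S. \<forall>y\<in>S. \<phi> (x + y) = \<phi> x + \<phi> y) \<and>
                              (\<forall>c. \<forall>x\<in>S. \<phi> (cscale c x) = c * \<phi> x)}"

text \<open>
  Contraction of a tensor \<open>t\<close> over \<open>L\<close> with a functional \<open>\<phi>\<close> on the tensor product over
  \<open>B \<subseteq> L\<close>: the entry at a multi-index \<open>j\<close> of \<open>L - B\<close> is \<open>\<phi>\<close> applied to the slice of \<open>t\<close> at \<open>j\<close>.
\<close>

definition slice :: "('v \<Rightarrow> nat) \<Rightarrow> 'v set \<Rightarrow> 'v tensor \<Rightarrow> ('v \<Rightarrow> nat) \<Rightarrow> 'v tensor" where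
  "slice d B t j = (\<lambda>i. if i \<in> multi_index d B then t (override_on j i B) else 0)"

definition contract ::
  "('v \<Rightarrow> nat) \<Rightarrow> 'v set \<Rightarrow> 'v set \<Rightarrow> ('v tensor \<Rightarrow> complex) \<Rightarrow> 'v tensor \<Rightarrow> 'v tensor" where
  "contract d L B \<phi> t = (\<lambda>j. if j \<in> multi_index d (L - B) then \<phi> (slice d B t j) else 0)"

definition flattening_rank :: "('v \<Rightarrow> nat) \<Rightarrow> 'v set \<Rightarrow> 'v set \<Rightarrow> 'v tensor \<Rightarrow> nat" where
  "flattening_rank d L B t =
     vector_space.dim cscale ((\<lambda>\<phi>. contract d L B \<phi> t) ` linear_functionals (tensor_space d B))"

text \<open>
  For an edge \<open>{u, v}\<close>, one side is the set of leaves still connected to \<open>u\<close> after the edge is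
  removed. The rank condition is imposed for both sides, so that no choice has to be made; the
  flattening ranks with respect to complementary sets of leaves agree.
\<close>

definition TNS ::
  "'v set \<Rightarrow> 'v set set \<Rightarrow> ('v \<Rightarrow> nat) \<Rightarrow> ('v set \<Rightarrow> nat) \<Rightarrow> 'v tensor set" where
  "TNS W E d f = {t \<in> tensor_space d (leaves W E).
     \<forall>e\<in>E. \<forall>u\<in>e.
       flattening_rank d (leaves W E) (component_of (E - {e}) u \<inter> leaves W E) t \<le> f e}"

section \<open>The Zariski topology\<close>

inductive_set polynomial_functions :: "(('i \<Rightarrow> complex) \<Rightarrow> complex) set" where
  const: "(\<lambda>x. c) \<in> polynomial_functions"
| coord: "(\<lambda>x. x i) \<in> polynomial_functions"
| add: "p \<in> polynomial_functions \<Longrightarrow> q \<in> polynomial_functions \<Longrightarrow>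
          (\<lambda>x. p x + q x) \<in> polynomial_functions"
| mult: "p \<in> polynomial_functions \<Longrightarrow> q \<in> polynomial_functions \<Longrightarrow>
          (\<lambda>x. p x * q x) \<in> polynomial_functions"

text \<open>The Zariski topology on a subspace \<open>S\<close>: complements of zero loci of sets of polynomials.\<close>

definition zariski :: "('i \<Rightarrow> complex) set \<Rightarrow> ('i \<Rightarrow> complex) topology" where
  "zariski S = topology (\<lambda>U. \<exists>P \<subseteq> polynomial_functions. U = S - {x. \<forall>p\<in>P. p x = 0})"

lemma istopology_zariski:
  fixes S :: "('i \<Rightarrow> complex) set"
  shows "istopology (\<lambda>U. \<exists>P \<subseteq> polynomial_functions. U = S - {x. \<forall>p\<in>P. p x = 0})"
  unfolding istopology_def
proof (intro conjI allI impI)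
  fix U U' :: "('i \<Rightarrow> complex) set"
  assume "\<exists>P \<subseteq> polynomial_functions. U = S - {x. \<forall>p\<in>P. p x = 0}"
    and "\<exists>P \<subseteq> polynomial_functions. U' = S - {x. \<forall>p\<in>P. p x = 0}"
  then obtain P P' where P: "P \<subseteq> polynomial_functions" "U = S - {x. \<forall>p\<in>P. p x = 0}"
    and P': "P' \<subseteq> polynomial_functions" "U' = S - {x. \<forall>p\<in>P'. p x = 0}" by blast
  let ?Q = "(\<lambda>(p, q) x. p x * q x) ` (P \<times> P')"
  have "?Q \<subseteq> polynomial_functions"
    using P(1) P'(1) by (auto intro: polynomial_functions.mult)
  moreover have "U \<inter> U' = S - {x. \<forall>p\<in>?Q. p x = 0}"
    unfolding P(2) P'(2) by auto
  ultimately show "\<exists>P \<subseteq> polynomial_functions. U \<inter> U' = S - {x. \<forall>p\<in>P. p x = 0}"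
    by (intro exI[of _ ?Q] conjI)
next
  fix \<U> :: "('i \<Rightarrow> complex) set set"
  assume "\<forall>U\<in>\<U>. \<exists>P \<subseteq> polynomial_functions. U = S - {x. \<forall>p\<in>P. p x = 0}"
  from bchoice[OF this] obtain P
    where "\<forall>U\<in>\<U>. P U \<subseteq> polynomial_functions \<and> U = S - {x. \<forall>p\<in>P U. p x = 0}" ..
  then have P: "\<And>U. U \<in> \<U> \<Longrightarrow> P U \<subseteq> polynomial_functions"
    "\<And>U. U \<in> \<U> \<Longrightarrow> U = S - {x. \<forall>p\<in>P U. p x = 0}" by simp_all
  have "\<Union>\<U> = S - {x. \<forall>p\<in>\<Union> (P ` \<U>). p x = 0}"
  proof
    show "\<Union>\<U> \<subseteq> S - {x. \<forall>p\<in>\<Union> (P ` \<U>). p x = 0}"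
    proof
      fix x assume "x \<in> \<Union>\<U>"
      then obtain U where U: "U \<in> \<U>" "x \<in> U" by blast
      then have "x \<in> S - {x. \<forall>p\<in>P U. p x = 0}" using P(2)[OF U(1)] by argo
      then show "x \<in> S - {x. \<forall>p\<in>\<Union> (P ` \<U>). p x = 0}" using U(1) by blast
    qed
    show "S - {x. \<forall>p\<in>\<Union> (P ` \<U>). p x = 0} \<subseteq> \<Union>\<U>"
    proof
      fix x assume "x \<in> S - {x. \<forall>p\<in>\<Union> (P ` \<U>). p x = 0}"
      then obtain U p where "x \<in> S" "U \<in> \<U>" "p \<in> P U" "p x \<noteq> 0" by blast
      then have "x \<in> S - {x. \<forall>p\<in>P U. p x = 0}" by blast
      then have "x \<in> U" using P(2)[OF \<open>U \<in> \<U>\<close>] by argo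
      with \<open>U \<in> \<U>\<close> show "x \<in> \<Union>\<U>" by blast
    qed
  qed
  moreover have "\<Union> (P ` \<U>) \<subseteq> polynomial_functions" using P(1) by (rule UN_least)
  ultimately show "\<exists>P \<subseteq> polynomial_functions. \<Union>\<U> = S - {x. \<forall>p\<in>P. p x = 0}"
    by (intro exI[of _ "\<Union> (P ` \<U>)"] conjI)
qed

lemma openin_zariski:
  "openin (zariski S) U \<longleftrightarrow>
     (\<exists>P \<subseteq> polynomial_functions. U = S - {x. \<forall>p\<in>P. p x = 0})"
  unfolding zariski_def by (simp only: topology_inverse'[OF istopology_zariski])

text \<open>
  A property holds for a generic element of \<open>X \<subseteq> S\<close> if it holds on a dense open subset of \<open>X\<close>,
  where \<open>X\<close> carries the Zariski topology induced from \<open>S\<close>.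
\<close>

definition generically ::
  "('i \<Rightarrow> complex) set \<Rightarrow> ('i \<Rightarrow> complex) set \<Rightarrow> (('i \<Rightarrow> complex) \<Rightarrow> bool) \<Rightarrow> bool" where
  "generically S X Q \<longleftrightarrow>
     (\<exists>U. openin (subtopology (zariski S) X) U \<and>
          subtopology (zariski S) X closure_of U = X \<and> (\<forall>t\<in>U. Q t))"

end

(*
Upper bound: the flattening rank is invariant under complements and submultiplicative on disjoint
unions. A colouring of the vertices that is 1 on A and 0 on the other leaves expresses A through
the leaf sets cut off by its bichromatic edges, so the rank at A is at most r to their number.

Lower bound: by max-flow min-cut there are minmono edge-disjoint paths from A to the other leaves.
Placing the tensor e_1 x e_1 + ... + e_r x e_r on the two ends of every path and a basis vector on
each remaining leaf gives an element of TNS whose rank at A is large enough.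

Genericity: the leaf sets of the edges form a laminar family, so that any two elements of TNS are
joined by a polynomial path inside TNS. A minor that is nonzero at one point of TNS is therefore
nonzero on a dense open subset.
*)
theory Submission
  imports Defs "Jordan_Normal_Form.Determinant"
begin

section \<open>Flattening ranks\<close>

text \<open>Density needs no parametrization of \<open>TNS\<close>: along a polynomial curve, a
  polynomial nonzero at one end and a minor nonzero at the other become nonzero polynomials in one
  variable, and these have a common nonroot. The obstacle in the tree arguments is that removing a
  pendant vertex changes which vertices are leaves, so an induction cannot speak of leaves. Instead,
  labels (tokens) sit at arbitrary vertices through a map \<open>loc\<close>, possibly several at
  one vertex, and move to the neighbour when their vertex is removed. In the max-flow statement a
  cut may therefore also miscolour tokens at unit price; at an actual leaf, whose degree is at most
  1, cutting its edge pays this price. The assumption \<open>d l \<ge> r\<close> supplies the basis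
  vectors needed at either end of a path. Since \<open>r \<ge> 1\<close>, powers of \<open>r\<close>
  grow with the exponent, so that inequalities between \<open>minmono\<close>, the number of paths
  and the number of cut edges suffice.\<close>

interpretation cvec: vector_space "cscale :: complex \<Rightarrow> ('i \<Rightarrow> complex) \<Rightarrow> _"
  by (rule vector_space_cscale)

lemma sum_fun_apply: "(\<Sum>s\<in>I. F s) x = (\<Sum>s\<in>I. F s x :: complex)"
  by (induction I rule: infinite_finite_induct) auto

text \<open>Stands in for membership in a tensor factor. Functions of the full multi-index that see
  only the coordinates in \<open>B\<close> can be multiplied pointwise with functions that see only
  the others, without splitting the index.\<close>

definition depends_on :: "'v set \<Rightarrow> (('v \<Rightarrow> nat) \<Rightarrow> 'b) \<Rightarrow> bool" where
  "depends_on B f \<longleftrightarrow> (\<forall>i j. (\<forall>l\<in>B. i l = j l) \<longrightarrow> f i = f j)"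

lemma depends_onD: "depends_on B f \<Longrightarrow> (\<And>l. l \<in> B \<Longrightarrow> i l = j l) \<Longrightarrow> f i = f j"
  unfolding depends_on_def by blast

lemma depends_onI: "(\<And>i j. (\<And>l. l \<in> B \<Longrightarrow> i l = j l) \<Longrightarrow> f i = f j) \<Longrightarrow> depends_on B f"
  unfolding depends_on_def by blast

lemma depends_on_restrict: "depends_on B (\<lambda>i. f (restrict i B))"
  by (rule depends_onI, rule arg_cong[of _ _ f]) (auto simp: restrict_def)

lemma finite_multi_index: "finite B \<Longrightarrow> finite (multi_index d B)"
  unfolding multi_index_def by (intro finite_PiE) auto

lemma multi_index_restrict: "i \<in> multi_index d L \<Longrightarrow> B \<subseteq> L \<Longrightarrow> restrict i B \<in> multi_index d B"
  unfolding multi_index_def by auto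

lemma multi_index_override:
  "j \<in> multi_index d (L - B) \<Longrightarrow> i \<in> multi_index d B \<Longrightarrow> B \<subseteq> L
     \<Longrightarrow> override_on j i B \<in> multi_index d L"
  unfolding multi_index_def by (auto simp: override_on_def PiE_iff extensional_def)

lemma multi_index_override':
  "j \<in> multi_index d L \<Longrightarrow> i \<in> multi_index d B \<Longrightarrow> B \<subseteq> L
     \<Longrightarrow> override_on j i B \<in> multi_index d L"
  unfolding multi_index_def by (auto simp: override_on_def PiE_iff extensional_def)

lemma functional_sum:
  assumes \<phi>: "\<phi> \<in> linear_functionals (tensor_space d B)"
    and F: "\<And>s. s \<in> I \<Longrightarrow> F s \<in> tensor_space d B"
  shows "\<phi> (\<lambda>i. \<Sum>s\<in>I. c s * F s i) = (\<Sum>s\<in>I. c s * \<phi> (F s))"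
proof -
  have zero: "(\<lambda>i. 0) \<in> tensor_space d B" by (simp add: tensor_space_def)
  have "\<phi> (cscale 0 (\<lambda>i. 0)) = 0 * \<phi> (\<lambda>i. 0)"
    using \<phi> zero unfolding linear_functionals_def by blast
  then have \<phi>0: "\<phi> (\<lambda>i. 0) = 0" by (simp add: cscale_def)
  show ?thesis using F
  proof (induction I rule: infinite_finite_induct)
    case (insert x J)
    have a: "(\<lambda>i. c x * F x i) \<in> tensor_space d B" "F x \<in> tensor_space d B"
      using insert.prems by (auto simp: tensor_space_def)
    have b: "(\<lambda>i. \<Sum>s\<in>J. c s * F s i) \<in> tensor_space d B"
      using insert.prems by (auto simp: tensor_space_def intro!: sum.neutral)
    have "\<phi> (\<lambda>i. \<Sum>s\<in>insert x J. c s * F s i)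
        = \<phi> ((\<lambda>i. c x * F x i) + (\<lambda>i. \<Sum>s\<in>J. c s * F s i))"
      using insert.hyps by (simp add: plus_fun_def)
    also have "\<dots> = \<phi> (cscale (c x) (F x)) + \<phi> (\<lambda>i. \<Sum>s\<in>J. c s * F s i)"
      using \<phi> a b unfolding linear_functionals_def cscale_def by simp
    also have "\<phi> (cscale (c x) (F x)) = c x * \<phi> (F x)"
      using \<phi> a(2) unfolding linear_functionals_def by simp
    finally show ?case using insert by simp
  qed (use \<phi>0 in auto)
qed

text \<open>Every slice of \<open>t\<close> is a combination of the fixed tensors \<open>F s\<close>
  with coefficients \<open>g s j\<close>; applying a functional thus gives a combination of the
  fixed vectors \<open>w s\<close>.\<close>

lemma flattening_rank_le_card:
  assumes "finite I" and "B \<subseteq> L"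
    and f: "\<And>s. s \<in> I \<Longrightarrow> depends_on B (f s)" and g: "\<And>s. s \<in> I \<Longrightarrow> depends_on (L - B) (g s)"
    and t: "\<And>i. i \<in> multi_index d L \<Longrightarrow> t i = (\<Sum>s\<in>I. f s i * g s i)"
  shows "flattening_rank d L B t \<le> card I"
proof -
  define w where "w s = (\<lambda>j. if j \<in> multi_index d (L - B) then g s j else 0)" for s
  define F where "F s = (\<lambda>i. if i \<in> multi_index d B then f s i else 0)" for s
  have "contract d L B \<phi> t \<in> cvec.span (w ` I)"
    if \<phi>: "\<phi> \<in> linear_functionals (tensor_space d B)" for \<phi>
  proof -
    have sl: "slice d B t j = (\<lambda>i. \<Sum>s\<in>I. g s j * F s i)" if j: "j \<in> multi_index d (L - B)" for j
    proof
      fix i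
      show "slice d B t j i = (\<Sum>s\<in>I. g s j * F s i)"
      proof (cases "i \<in> multi_index d B")
        case True
        have "t (override_on j i B) = (\<Sum>s\<in>I. f s (override_on j i B) * g s (override_on j i B))"
          using True assms(2) j by (intro t multi_index_override)
        also have "\<dots> = (\<Sum>s\<in>I. f s i * g s j)"
          by (intro sum.cong refl arg_cong2[of _ _ _ _ "(*)"] depends_onD[OF f] depends_onD[OF g])
             (auto simp: override_on_def)
        finally show ?thesis using True by (simp add: slice_def F_def mult.commute)
      qed (simp add: slice_def F_def)
    qed
    have "contract d L B \<phi> t = (\<Sum>s\<in>I. cscale (\<phi> (F s)) (w s))"
    proof
      fix j
      show "contract d L B \<phi> t j = (\<Sum>s\<in>I. cscale (\<phi> (F s)) (w s)) j"
        using sl[of j] functional_sum[OF \<phi>, of I F "\<lambda>s. g s j"]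
        by (auto simp: contract_def sum_fun_apply cscale_def w_def F_def tensor_space_def mult.commute)
    qed
    also have "\<dots> \<in> cvec.span (w ` I)"
      by (intro cvec.span_sum cvec.span_scale cvec.span_base) auto
    finally show ?thesis .
  qed
  then have "flattening_rank d L B t \<le> card (w ` I)"
    unfolding flattening_rank_def using \<open>finite I\<close> by (intro cvec.dim_le_card) auto
  then show ?thesis using card_image_le[OF \<open>finite I\<close>, of w] by linarith
qed

text \<open>An operator of rank at most \<open>n\<close> on the factor \<open>B\<close> fixes
  \<open>t\<close>. Compared with a plain sum of products, the second factor is itself obtained
  linearly from \<open>t\<close>; this allows the formula to be nested for two sets and the operator
  to be deformed.\<close>

lemma flattening_rank_projection:
  assumes "finite L" and "B \<subseteq> L" and rank: "flattening_rank d L B t \<le> n"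
  obtains u \<phi> where "\<And>i. i \<in> multi_index d L \<Longrightarrow>
    t i = (\<Sum>s<n. u s (restrict i B) * (\<Sum>i'\<in>multi_index d B. \<phi> s i' * t (override_on i i' B)))"
proof -
  have fin: "finite (multi_index d B)"
    using assms by (meson finite_multi_index finite_subset)
  define R where "R = (\<lambda>\<phi>. contract d L B \<phi> t) ` linear_functionals (tensor_space d B)"
  define \<delta> :: "('a \<Rightarrow> nat) \<Rightarrow> 'a tensor" where "\<delta> i' = (\<lambda>i. if i = i' then 1 else 0)" for i'
  define c where "c i' = contract d L B (\<lambda>x. x i') t" for i'
  have c: "c i' j = (if j \<in> multi_index d (L - B) then t (override_on j i' B) else 0)"
    if "i' \<in> multi_index d B" for i' j
    using that by (simp add: c_def contract_def slice_def)
  have c_R: "c i' \<in> R" for i'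
    unfolding R_def c_def by (rule imageI) (simp add: linear_functionals_def cscale_def)
  \<comment> \<open>Expanding functionals in the unit tensors \<open>\<delta> i'\<close> shows that
    the finitely many coordinate contractions \<open>c i'\<close> span \<open>R\<close>.\<close>
  have R_c: "contract d L B \<psi> t = (\<Sum>i'\<in>multi_index d B. cscale (\<psi> (\<delta> i')) (c i'))"
    if \<psi>: "\<psi> \<in> linear_functionals (tensor_space d B)" for \<psi>
  proof
    fix j
    have "slice d B t j = (\<lambda>i. \<Sum>i'\<in>multi_index d B. slice d B t j i' * \<delta> i' i)"
    proof
      fix i
      have "(\<Sum>i'\<in>multi_index d B. slice d B t j i' * \<delta> i' i)
          = (\<Sum>i'\<in>multi_index d B. if i = i' then slice d B t j i else 0)"
        by (intro sum.cong) (auto simp: \<delta>_def)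
      also have "\<dots> = slice d B t j i" using fin by (simp add: slice_def)
      finally show "slice d B t j i = (\<Sum>i'\<in>multi_index d B. slice d B t j i' * \<delta> i' i)" by simp
    qed
    then have "\<psi> (slice d B t j) = (\<Sum>i'\<in>multi_index d B. slice d B t j i' * \<psi> (\<delta> i'))"
      using functional_sum[OF \<psi>, of "multi_index d B" \<delta> "slice d B t j"]
      by (auto simp: \<delta>_def tensor_space_def)
    then show "contract d L B \<psi> t j = (\<Sum>i'\<in>multi_index d B. cscale (\<psi> (\<delta> i')) (c i')) j"
      by (auto simp: contract_def sum_fun_apply cscale_def c slice_def mult.commute intro!: sum.cong)
  qed
  \<comment> \<open>The basis is taken inside \<open>R\<close>, so each of its elements is a
    contraction of \<open>t\<close>; its coefficients in terms of the \<open>c i'\<close> become the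
    functional \<open>\<phi> s\<close>.\<close>
  obtain Bs where Bs: "Bs \<subseteq> R" "cvec.independent Bs" "R \<subseteq> cvec.span Bs" "card Bs = cvec.dim R"
    by (rule cvec.basis_exists)
  have "R \<subseteq> cvec.span (c ` multi_index d B)"
    unfolding R_def
    by (auto simp: R_c intro!: cvec.span_sum cvec.span_scale intro: cvec.span_base)
  then have "finite Bs"
    using cvec.independent_span_bound[of "c ` multi_index d B" Bs] Bs fin by blast
  have "card Bs \<le> n" using rank Bs(4) unfolding flattening_rank_def R_def by simp
  obtain h where h: "bij_betw h {..<card Bs} Bs"
    using ex_bij_betw_nat_finite[OF \<open>finite Bs\<close>] by (auto simp: atLeast0LessThan)
  have "\<forall>s. \<exists>\<phi>. s < card Bs \<longrightarrow> h s = (\<Sum>i'\<in>multi_index d B. cscale (\<phi> i') (c i'))"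
  proof
    fix s
    show "\<exists>\<phi>. s < card Bs \<longrightarrow> h s = (\<Sum>i'\<in>multi_index d B. cscale (\<phi> i') (c i'))"
    proof (cases "s < card Bs")
      case True
      then have "h s \<in> R" using h Bs(1) bij_betwE by blast
      then show ?thesis unfolding R_def using R_c by auto
    qed auto
  qed
  then obtain \<phi> where \<phi>: "\<And>s. s < card Bs \<Longrightarrow> h s = (\<Sum>i'\<in>multi_index d B. cscale (\<phi> s i') (c i'))"
    by metis
  have "\<exists>u. c i' = (\<Sum>b\<in>Bs. cscale (u b) b)" for i'
    using c_R[of i'] Bs(3) cvec.span_finite[OF \<open>finite Bs\<close>] by blast
  then obtain v where v: "\<And>i'. c i' = (\<Sum>b\<in>Bs. cscale (v i' b) b)" by metis
  \<comment> \<open>Padding with zero terms passes from the exact rank \<open>card Bs\<close> to the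
    given bound \<open>n\<close>.\<close>
  define u where "u s i' = (if s < card Bs then v i' (h s) else 0)" for s i'
  show thesis
  proof
    fix i assume i: "i \<in> multi_index d L"
    have rB: "restrict i B \<in> multi_index d B" "restrict i (L - B) \<in> multi_index d (L - B)"
      using i assms(2) by (auto intro: multi_index_restrict)
    have ov: "override_on (restrict i (L - B)) i' B = override_on i i' B" for i'
      using i assms(2) by (auto simp: override_on_def fun_eq_iff multi_index_def PiE_iff extensional_def)
    have "override_on i (restrict i B) B = i" by (auto simp: override_on_def)
    then have "t i = c (restrict i B) (restrict i (L - B))"
      using c[OF rB(1)] rB(2) ov by simp
    also have "\<dots> = (\<Sum>b\<in>Bs. v (restrict i B) b * b (restrict i (L - B)))"
      by (subst v) (simp add: sum_fun_apply cscale_def)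
    also have "\<dots> = (\<Sum>s<card Bs. v (restrict i B) (h s) * h s (restrict i (L - B)))"
      by (rule sum.reindex_bij_betw[OF h, symmetric])
    also have "\<dots> = (\<Sum>s<card Bs. u s (restrict i B) *
        (\<Sum>i'\<in>multi_index d B. \<phi> s i' * t (override_on i i' B)))"
      using rB(2) by (intro sum.cong) (auto simp: u_def \<phi> sum_fun_apply cscale_def c ov)
    also have "\<dots> = (\<Sum>s<n. u s (restrict i B) *
        (\<Sum>i'\<in>multi_index d B. \<phi> s i' * t (override_on i i' B)))"
      using \<open>card Bs \<le> n\<close> by (intro sum.mono_neutral_left) (auto simp: u_def)
    finally show "t i = (\<Sum>s<n. u s (restrict i B) *
        (\<Sum>i'\<in>multi_index d B. \<phi> s i' * t (override_on i i' B)))" .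
  qed
qed

lemma flattening_rank_decomposition:
  assumes "finite L" and "B \<subseteq> L" and "flattening_rank d L B t \<le> n"
  obtains f g where "\<And>s. depends_on B (f s)" "\<And>s. depends_on (L - B) (g s)"
    "\<And>i. i \<in> multi_index d L \<Longrightarrow> t i = (\<Sum>s<n. f s i * g s i)"
proof -
  obtain u \<phi> where t: "\<And>i. i \<in> multi_index d L \<Longrightarrow>
    t i = (\<Sum>s<n. u s (restrict i B) * (\<Sum>i'\<in>multi_index d B. \<phi> s i' * t (override_on i i' B)))"
    using flattening_rank_projection[OF assms] by blast
  show thesis
  proof
    show "depends_on B (\<lambda>i. u s (restrict i B))" for s by (rule depends_on_restrict)
    show "depends_on (L - B)
        (\<lambda>i. \<Sum>i'\<in>multi_index d B. \<phi> s i' * t (override_on (restrict i (L - B)) i' B))" for s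
      by (rule depends_on_restrict)
    fix i assume i: "i \<in> multi_index d L"
    have "override_on (restrict i (L - B)) i' B = override_on i i' B" for i'
      using i assms(2) by (auto simp: override_on_def fun_eq_iff multi_index_def PiE_iff extensional_def)
    then show "t i = (\<Sum>s<n. u s (restrict i B) *
      (\<Sum>i'\<in>multi_index d B. \<phi> s i' * t (override_on (restrict i (L - B)) i' B)))"
      using t[OF i] by simp
  qed
qed

text \<open>A decomposition into products treats both sides alike: row rank against column
  rank.\<close>

lemma flattening_rank_compl_le:
  assumes "finite L" and "B \<subseteq> L"
  shows "flattening_rank d L (L - B) t \<le> flattening_rank d L B t"
proof -
  obtain f g where fg: "\<And>s. depends_on B (f s)" "\<And>s. depends_on (L - B) (g s)"
    "\<And>i. i \<in> multi_index d L \<Longrightarrow> t i = (\<Sum>s<flattening_rank d L B t. f s i * g s i)"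
    using flattening_rank_decomposition[OF assms order_refl, of d t] by metis
  have "L - (L - B) = B" using assms(2) by auto
  then have "flattening_rank d L (L - B) t \<le> card {..<flattening_rank d L B t}"
    using fg by (intro flattening_rank_le_card[where f = g and g = f]) (auto simp: mult.commute)
  then show ?thesis by simp
qed

lemma flattening_rank_compl:
  assumes "finite L" and "B \<subseteq> L"
  shows "flattening_rank d L (L - B) t = flattening_rank d L B t"
  using flattening_rank_compl_le[OF assms, of d t]
    flattening_rank_compl_le[OF assms(1), of "L - B" d t] assms(2)
  by (simp add: double_diff order_antisym)

text \<open>The projection formula at \<open>X\<close> is applied first, then the one at
  \<open>Y\<close> inside it. Afterwards all coordinates in \<open>X\<close> and \<open>Y\<close> at
  which \<open>t\<close> is evaluated are summation variables, so the inner factor sees only the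
  rest. Disjointness keeps the \<open>Y\<close>-coordinates of \<open>i\<close> intact under the
  first substitution.\<close>

lemma flattening_rank_Un_le:
  assumes "finite L" and XY: "X \<subseteq> L" "Y \<subseteq> L" "X \<inter> Y = {}"
  shows "flattening_rank d L (X \<union> Y) t \<le> flattening_rank d L X t * flattening_rank d L Y t"
proof -
  let ?m = "flattening_rank d L X t" and ?n = "flattening_rank d L Y t"
  obtain u \<phi> where u: "\<And>i. i \<in> multi_index d L \<Longrightarrow>
    t i = (\<Sum>s<?m. u s (restrict i X) * (\<Sum>i'\<in>multi_index d X. \<phi> s i' * t (override_on i i' X)))"
    using flattening_rank_projection[OF assms(1) XY(1) order_refl, of d t] by blast
  obtain v \<psi> where v: "\<And>i. i \<in> multi_index d L \<Longrightarrow>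
    t i = (\<Sum>q<?n. v q (restrict i Y) * (\<Sum>j'\<in>multi_index d Y. \<psi> q j' * t (override_on i j' Y)))"
    using flattening_rank_projection[OF assms(1) XY(2) order_refl, of d t] by blast
  define Z where "Z = L - (X \<union> Y)"
  define f where "f = (\<lambda>(s, q) i. u s (restrict i X) * v q (restrict i Y))"
  define g where "g = (\<lambda>(s, q) i. \<Sum>i'\<in>multi_index d X. \<Sum>j'\<in>multi_index d Y.
     \<phi> s i' * \<psi> q j' * t (override_on (override_on (restrict i Z) i' X) j' Y))"
  have "flattening_rank d L (X \<union> Y) t \<le> card ({..<?m} \<times> {..<?n})"
  proof (rule flattening_rank_le_card)
    fix p :: "nat \<times> nat"
    obtain s q where p: "p = (s, q)" by fastforce
    show "depends_on (X \<union> Y) (f p)"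
    proof (rule depends_onI)
      fix i j :: "'a \<Rightarrow> nat"
      assume "\<And>l. l \<in> X \<union> Y \<Longrightarrow> i l = j l"
      then have "restrict i X = restrict j X" "restrict i Y = restrict j Y"
        by (auto simp: restrict_def)
      then show "f p i = f p j" by (simp add: f_def p)
    qed
    show "depends_on (L - (X \<union> Y)) (g p)"
      unfolding g_def p prod.case Z_def by (rule depends_on_restrict)
  next
    fix i assume i: "i \<in> multi_index d L"
    have "t i = (\<Sum>s<?m. u s (restrict i X) * (\<Sum>i'\<in>multi_index d X. \<phi> s i' *
        (\<Sum>q<?n. v q (restrict i Y) * (\<Sum>j'\<in>multi_index d Y. \<psi> q j' *
           t (override_on (override_on (restrict i Z) i' X) j' Y)))))"
    proof (subst u[OF i], intro sum.cong refl arg_cong2[of _ _ _ _ "(*)"])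
      fix i' assume i': "i' \<in> multi_index d X"
      have "override_on i i' X \<in> multi_index d L" using i i' XY(1) by (rule multi_index_override')
      moreover have "restrict (override_on i i' X) Y = restrict i Y"
        using XY(3) by (auto simp: restrict_def override_on_def fun_eq_iff)
      moreover have "override_on (override_on i i' X) j' Y
          = override_on (override_on (restrict i Z) i' X) j' Y" for j'
        using i by (auto simp: override_on_def fun_eq_iff Z_def multi_index_def PiE_iff extensional_def)
      ultimately show "t (override_on i i' X) = (\<Sum>q<?n. v q (restrict i Y) *
          (\<Sum>j'\<in>multi_index d Y. \<psi> q j' * t (override_on (override_on (restrict i Z) i' X) j' Y)))"
        by (subst v) auto
    qed
    also have "\<dots> = (\<Sum>s<?m. \<Sum>q<?n. f (s, q) i * g (s, q) i)"
    proof (rule sum.cong[OF refl])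
      fix s
      show "u s (restrict i X) * (\<Sum>i'\<in>multi_index d X. \<phi> s i' *
        (\<Sum>q<?n. v q (restrict i Y) * (\<Sum>j'\<in>multi_index d Y. \<psi> q j' *
           t (override_on (override_on (restrict i Z) i' X) j' Y)))) = (\<Sum>q<?n. f (s, q) i * g (s, q) i)"
        unfolding sum_distrib_left f_def g_def prod.case
        by (subst sum.swap) (simp add: mult_ac)
    qed
    also have "\<dots> = (\<Sum>p\<in>{..<?m} \<times> {..<?n}. f p i * g p i)"
      by (simp add: sum.cartesian_product)
    finally show "t i = (\<Sum>p\<in>{..<?m} \<times> {..<?n}. f p i * g p i)" .
  qed (use XY in auto)
  then show ?thesis by simp
qed

lemma flattening_rank_empty_le: "flattening_rank d L {} t \<le> 1"
proof -
  have "flattening_rank d L {} t \<le> card {()}"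
  proof (rule flattening_rank_le_card)
    show "depends_on {} (\<lambda>i. 1 :: complex)" by (rule depends_onI) simp
    show "depends_on (L - {}) (\<lambda>i. t (restrict i L))" using depends_on_restrict[of L t] by simp
    fix i assume "i \<in> multi_index d L"
    then have "restrict i L = i" by (auto simp: multi_index_def PiE_iff extensional_restrict)
    then show "t i = (\<Sum>s\<in>{()}. 1 * t (restrict i L))" by simp
  qed auto
  then show ?thesis by simp
qed

section \<open>Polynomial paths\<close>

definition poly_fun :: "(complex \<Rightarrow> complex) \<Rightarrow> bool" where
  "poly_fun f \<longleftrightarrow> (\<exists>q. f = poly q)"

lemma poly_fun_const: "poly_fun (\<lambda>s. c)"
  unfolding poly_fun_def by (rule exI[of _ "[:c:]"]) auto

lemma poly_fun_ident: "poly_fun (\<lambda>s. s)"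
  unfolding poly_fun_def by (rule exI[of _ "[:0, 1:]"]) auto

lemma poly_fun_add: "poly_fun f \<Longrightarrow> poly_fun g \<Longrightarrow> poly_fun (\<lambda>s. f s + g s)"
proof -
  assume "poly_fun f" "poly_fun g"
  then obtain p q where "f = poly p" "g = poly q" unfolding poly_fun_def by blast
  then show ?thesis unfolding poly_fun_def by (intro exI[of _ "p + q"]) auto
qed

lemma poly_fun_diff: "poly_fun f \<Longrightarrow> poly_fun g \<Longrightarrow> poly_fun (\<lambda>s. f s - g s)"
proof -
  assume "poly_fun f" "poly_fun g"
  then obtain p q where "f = poly p" "g = poly q" unfolding poly_fun_def by blast
  then show ?thesis unfolding poly_fun_def by (intro exI[of _ "p - q"]) auto
qed

lemma poly_fun_mult: "poly_fun f \<Longrightarrow> poly_fun g \<Longrightarrow> poly_fun (\<lambda>s. f s * g s)"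
proof -
  assume "poly_fun f" "poly_fun g"
  then obtain p q where "f = poly p" "g = poly q" unfolding poly_fun_def by blast
  then show ?thesis unfolding poly_fun_def by (intro exI[of _ "p * q"]) auto
qed

lemma poly_fun_sum: "(\<And>a. a \<in> I \<Longrightarrow> poly_fun (f a)) \<Longrightarrow> poly_fun (\<lambda>s. \<Sum>a\<in>I. f a s)"
  by (induction I rule: infinite_finite_induct) (simp_all add: poly_fun_const poly_fun_add)

lemmas poly_fun_intros =
  poly_fun_const poly_fun_ident poly_fun_add poly_fun_diff poly_fun_mult poly_fun_sum

lemma poly_fun_comp_polynomial_function:
  assumes "p \<in> polynomial_functions" and "\<And>i. poly_fun (\<lambda>s. \<gamma> s i)"
  shows "poly_fun (\<lambda>s. p (\<gamma> s))"
  using assms(1) by induction (simp_all add: poly_fun_const poly_fun_add poly_fun_mult assms(2))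

text \<open>A nonzero product of polynomials has finitely many roots, while the field is infinite.
  This irreducibility of the line is what the paths carry over to the variety.\<close>

lemma poly_fun_common_nonzero:
  assumes "poly_fun f" "poly_fun g" "f a \<noteq> 0" "g b \<noteq> 0"
  obtains s where "f s \<noteq> 0" "g s \<noteq> 0"
proof -
  obtain p q where pq: "f = poly p" "g = poly q" using assms(1,2) unfolding poly_fun_def by blast
  with assms(3,4) have "p * q \<noteq> 0" by auto
  then have "finite {s. poly (p * q) s = 0}" by (rule poly_roots_finite)
  then obtain s where "poly (p * q) s \<noteq> 0"
    using infinite_UNIV_char_0[where 'a = complex] by (metis (mono_tags) UNIV_eq_I mem_Collect_eq)
  then show thesis using that[of s] pq by simp
qed

text \<open>The operator with matrix \<open>X\<close> on the factor \<open>B\<close>, tensored with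
  the identity on the factor \<open>L - B\<close>.\<close>

definition local_op ::
  "('v \<Rightarrow> nat) \<Rightarrow> 'v set \<Rightarrow> 'v set \<Rightarrow> (('v \<Rightarrow> nat) \<Rightarrow> ('v \<Rightarrow> nat) \<Rightarrow> complex) \<Rightarrow> 'v tensor \<Rightarrow> 'v tensor" where
  "local_op d L B X t = (\<lambda>i. if i \<in> multi_index d L
     then \<Sum>i'\<in>multi_index d B. X (restrict i B) i' * t (override_on i i' B) else 0)"

text \<open>The operator changes only the factors \<open>f s\<close> on the side of
  \<open>C\<close>; the number of products stays the same.\<close>

lemma flattening_rank_local_op_superset:
  assumes "finite L" and "B \<subseteq> C" and "C \<subseteq> L"
  shows "flattening_rank d L C (local_op d L B X t) \<le> flattening_rank d L C t"
proof -
  let ?n = "flattening_rank d L C t"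
  obtain f g where f: "\<And>s. depends_on C (f s)" and g: "\<And>s. depends_on (L - C) (g s)"
    and t: "\<And>i. i \<in> multi_index d L \<Longrightarrow> t i = (\<Sum>s<?n. f s i * g s i)"
    using flattening_rank_decomposition[OF assms(1,3) order_refl, of d t] by metis
  define h where "h s i = (\<Sum>i'\<in>multi_index d B. X (restrict i B) i' * f s (override_on i i' B))" for s i
  have "flattening_rank d L C (local_op d L B X t) \<le> card {..<?n}"
  proof (rule flattening_rank_le_card)
    show "depends_on C (h s)" for s
    proof (rule depends_onI)
      fix i j :: "'a \<Rightarrow> nat" assume ij: "\<And>l. l \<in> C \<Longrightarrow> i l = j l"
      have "restrict i B = restrict j B" using ij assms(2) by (auto simp: restrict_def fun_eq_iff)
      moreover have "f s (override_on i i' B) = f s (override_on j i' B)" for i'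
        using ij by (intro depends_onD[OF f]) (auto simp: override_on_def)
      ultimately show "h s i = h s j" by (simp add: h_def)
    qed
    fix i assume i: "i \<in> multi_index d L"
    have gi: "g s (override_on i i' B) = g s i" for s i'
      using assms(2) by (intro depends_onD[OF g]) (auto simp: override_on_def)
    have "local_op d L B X t i = (\<Sum>i'\<in>multi_index d B. X (restrict i B) i' *
        (\<Sum>s<?n. f s (override_on i i' B) * g s i))"
      using i assms(2,3) by (auto simp: local_op_def t gi multi_index_override' intro!: sum.cong)
    also have "\<dots> = (\<Sum>s<?n. h s i * g s i)"
      unfolding h_def sum_distrib_left sum_distrib_right
      by (subst sum.swap) (simp add: mult_ac)
    finally show "local_op d L B X t i = (\<Sum>s<?n. h s i * g s i)" .
  qed (use assms g in auto)
  then show ?thesis by simp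
qed

lemma flattening_rank_local_op_disjoint:
  assumes "finite L" and "B \<inter> C = {}" and "B \<subseteq> L" and "C \<subseteq> L"
  shows "flattening_rank d L C (local_op d L B X t) \<le> flattening_rank d L C t"
  using flattening_rank_local_op_superset[of L B "L - C" d X t] assms
    flattening_rank_compl[OF assms(1,4), of d] by auto

text \<open>The matrix is given in factored form, so each of its \<open>n\<close> rank-one summands
  contributes one product.\<close>

lemma flattening_rank_local_op_le:
  assumes "finite L" and "B \<subseteq> L"
  shows "flattening_rank d L B (local_op d L B (\<lambda>x x'. \<Sum>a<n. u a x * \<phi> a x') t) \<le> n"
proof -
  define g where "g a i = (\<Sum>i'\<in>multi_index d B. \<phi> a i' * t (override_on (restrict i (L - B)) i' B))" for a i
  have "flattening_rank d L B (local_op d L B (\<lambda>x x'. \<Sum>a<n. u a x * \<phi> a x') t) \<le> card {..<n}"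
  proof (rule flattening_rank_le_card)
    show "depends_on B (\<lambda>i. u a (restrict i B))" for a by (rule depends_on_restrict)
    show "depends_on (L - B) (g a)" for a unfolding g_def by (rule depends_on_restrict)
    fix i assume i: "i \<in> multi_index d L"
    then have ov: "override_on (restrict i (L - B)) i' B = override_on i i' B" for i'
      using assms(2) by (auto simp: override_on_def fun_eq_iff multi_index_def PiE_iff extensional_def)
    show "local_op d L B (\<lambda>x x'. \<Sum>a<n. u a x * \<phi> a x') t i = (\<Sum>a<n. u a (restrict i B) * g a i)"
      using i unfolding local_op_def g_def ov sum_distrib_left sum_distrib_right
      by (subst sum.swap) (simp add: mult_ac)
  qed (use assms in auto)
  then show ?thesis by simp
qed

text \<open>
  Projecting a tensor onto its flattening space at \<open>B\<close> fixes it, whereas an arbitrary operator of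
  rank at most \<open>r\<close> on the factors in \<open>B\<close> forces the rank bound at \<open>B\<close> and preserves the bounds at
  sets containing or avoiding \<open>B\<close>. Interpolating these operators, larger sets first, connects any
  two points of the variety inside the variety.
\<close>

lemma laminar_polynomial_path:
  assumes "finite L" and "finite F"
    and "\<And>B. B \<in> F \<Longrightarrow> B \<subseteq> L"
    and "\<And>B C. B \<in> F \<Longrightarrow> C \<in> F \<Longrightarrow> B \<subseteq> C \<or> C \<subseteq> B \<or> B \<inter> C = {}"
    and t: "t\<^sub>0 \<in> tensor_space d L" "t\<^sub>1 \<in> tensor_space d L"
    and "\<And>B. B \<in> F \<Longrightarrow> flattening_rank d L B t\<^sub>0 \<le> r"
    and "\<And>B. B \<in> F \<Longrightarrow> flattening_rank d L B t\<^sub>1 \<le> r"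
  shows "\<exists>\<gamma>. (\<forall>i. poly_fun (\<lambda>s. \<gamma> s i)) \<and> \<gamma> 0 = t\<^sub>0 \<and> \<gamma> 1 = t\<^sub>1 \<and>
    (\<forall>s. \<gamma> s \<in> tensor_space d L \<and> (\<forall>B\<in>F. flattening_rank d L B (\<gamma> s) \<le> r))"
  using assms(2,3,4,7,8)
\<comment> \<open>Ranking by negative cardinality makes the inserted \<open>B\<close> no larger than
  any earlier set; by laminarity each earlier set then contains \<open>B\<close> or is disjoint from
  it.\<close>
proof (induction F rule: finite_ranking_induct[where f = "\<lambda>B. - int (card B)"])
  case empty
  have "poly_fun (\<lambda>s. (1 - s) * t\<^sub>0 i + s * t\<^sub>1 i)" for i by (intro poly_fun_intros)
  then show ?case
    using t by (intro exI[of _ "\<lambda>s i. (1 - s) * t\<^sub>0 i + s * t\<^sub>1 i"]) (auto simp: tensor_space_def)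
next
  case (insert B F)
  have "\<exists>\<gamma>. (\<forall>i. poly_fun (\<lambda>s. \<gamma> s i)) \<and> \<gamma> 0 = t\<^sub>0 \<and> \<gamma> 1 = t\<^sub>1 \<and>
    (\<forall>s. \<gamma> s \<in> tensor_space d L \<and> (\<forall>B\<in>F. flattening_rank d L B (\<gamma> s) \<le> r))"
    by (rule insert.IH) (use insert.prems in auto)
  then obtain \<gamma> where \<gamma>: "\<And>i. poly_fun (\<lambda>s. \<gamma> s i)" "\<gamma> 0 = t\<^sub>0" "\<gamma> 1 = t\<^sub>1"
    "\<And>s. \<gamma> s \<in> tensor_space d L" "\<And>s C. C \<in> F \<Longrightarrow> flattening_rank d L C (\<gamma> s) \<le> r" by metis
  have B: "B \<subseteq> L" using insert.prems(1) by simp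
  obtain u\<^sub>0 \<phi>\<^sub>0 where t0: "\<And>i. i \<in> multi_index d L \<Longrightarrow> t\<^sub>0 i =
      (\<Sum>a<r. u\<^sub>0 a (restrict i B) * (\<Sum>i'\<in>multi_index d B. \<phi>\<^sub>0 a i' * t\<^sub>0 (override_on i i' B)))"
    using flattening_rank_projection[OF assms(1) B insert.prems(3)[OF insertI1]] by blast
  obtain u\<^sub>1 \<phi>\<^sub>1 where t1: "\<And>i. i \<in> multi_index d L \<Longrightarrow> t\<^sub>1 i =
      (\<Sum>a<r. u\<^sub>1 a (restrict i B) * (\<Sum>i'\<in>multi_index d B. \<phi>\<^sub>1 a i' * t\<^sub>1 (override_on i i' B)))"
    using flattening_rank_projection[OF assms(1) B insert.prems(4)[OF insertI1]] by blast
  \<comment> \<open>The two factors are interpolated separately. Interpolating the operators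
    themselves would only bound the rank by \<open>2 * r\<close>.\<close>
  define u where "u s a x = (1 - s) * u\<^sub>0 a x + s * u\<^sub>1 a x" for s a x
  define \<phi> where "\<phi> s a x = (1 - s) * \<phi>\<^sub>0 a x + s * \<phi>\<^sub>1 a x" for s a x
  define \<gamma>' where "\<gamma>' s = local_op d L B (\<lambda>x x'. \<Sum>a<r. u s a x * \<phi> s a x') (\<gamma> s)" for s
  have swap: "(\<Sum>i'\<in>multi_index d B. (\<Sum>a<r. v a * \<psi> a i') * y i')
      = (\<Sum>a<r. v a * (\<Sum>i'\<in>multi_index d B. \<psi> a i' * y i'))" for v :: "nat \<Rightarrow> complex" and \<psi> y
    unfolding sum_distrib_left sum_distrib_right by (subst sum.swap) (simp add: mult_ac)
  show ?case
  proof (intro exI[of _ \<gamma>'] conjI allI ballI)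
    show "poly_fun (\<lambda>s. \<gamma>' s i)" for i
      by (cases "i \<in> multi_index d L")
         (auto simp: \<gamma>'_def local_op_def u_def \<phi>_def intro!: poly_fun_intros \<gamma>(1))
    show "\<gamma>' 0 = t\<^sub>0"
    proof
      fix i show "\<gamma>' 0 i = t\<^sub>0 i"
        by (cases "i \<in> multi_index d L")
          (use t(1) in \<open>auto simp: \<gamma>'_def local_op_def u_def \<phi>_def swap \<gamma>(2) t0[symmetric] tensor_space_def\<close>)
    qed
    show "\<gamma>' 1 = t\<^sub>1"
    proof
      fix i show "\<gamma>' 1 i = t\<^sub>1 i"
        by (cases "i \<in> multi_index d L")
          (use t(2) in \<open>auto simp: \<gamma>'_def local_op_def u_def \<phi>_def swap \<gamma>(3) t1[symmetric] tensor_space_def\<close>)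
    qed
    fix s
    show "\<gamma>' s \<in> tensor_space d L" by (auto simp: \<gamma>'_def local_op_def tensor_space_def)
    fix C assume C: "C \<in> insert B F"
    show "flattening_rank d L C (\<gamma>' s) \<le> r"
    proof (cases "C = B")
      case True
      then show ?thesis unfolding \<gamma>'_def using flattening_rank_local_op_le[OF assms(1) B] by simp
    next
      case False
      then have CF: "C \<in> F" and CL: "C \<subseteq> L" using C insert.prems(1) by auto
      have card: "card B \<le> card C" using insert.hyps(2)[OF CF] by simp
      have "\<not> C \<subseteq> B"
        using card False B assms(1) by (metis card_seteq finite_subset)
      then have "B \<subseteq> C \<or> B \<inter> C = {}" using insert.prems(2)[of B C] C by auto
      then have "flattening_rank d L C (\<gamma>' s) \<le> flattening_rank d L C (\<gamma> s)"
        unfolding \<gamma>'_def using B CL assms(1)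
        by (auto intro: flattening_rank_local_op_superset flattening_rank_local_op_disjoint)
      then show ?thesis using \<gamma>(5)[OF CF, of s] by linarith
    qed
  qed
qed

section \<open>Minors of flattenings and Zariski density\<close>

lemma polynomial_functions_sum:
  "(\<And>a. a \<in> I \<Longrightarrow> p a \<in> polynomial_functions) \<Longrightarrow> (\<lambda>x. \<Sum>a\<in>I. p a x) \<in> polynomial_functions"
  by (induction I rule: infinite_finite_induct)
     (simp_all add: polynomial_functions.const polynomial_functions.add)

lemma polynomial_functions_prod:
  "(\<And>a. a \<in> I \<Longrightarrow> p a \<in> polynomial_functions) \<Longrightarrow> (\<lambda>x. \<Prod>a\<in>I. p a x) \<in> polynomial_functions"
  by (induction I rule: infinite_finite_induct)
     (simp_all add: polynomial_functions.const polynomial_functions.mult)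

definition flattening_minor ::
  "'v set \<Rightarrow> nat \<Rightarrow> (nat \<Rightarrow> 'v \<Rightarrow> nat) \<Rightarrow> (nat \<Rightarrow> 'v \<Rightarrow> nat) \<Rightarrow> 'v tensor \<Rightarrow> complex" where
  "flattening_minor A N x y t = Determinant.det (mat N N (\<lambda>(a, b). t (override_on (y b) (x a) A)))"

lemma flattening_minor_polynomial: "flattening_minor A N x y \<in> polynomial_functions"
proof -
  have "flattening_minor A N x y = (\<lambda>t. \<Sum>p | p permutes {0..<N}.
      signof p * (\<Prod>a = 0..<N. t (override_on (y (p a)) (x a) A)))"
    unfolding flattening_minor_def
    by (rule ext, subst det_def') (auto intro!: sum.cong prod.cong dest: permutes_in_image)
  also have "\<dots> \<in> polynomial_functions"
    by (intro polynomial_functions_sum polynomial_functions_prod polynomial_functions.intros)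
  finally show ?thesis .
qed

lemma flattening_rank_ge_minor:
  assumes "finite L" and "A \<subseteq> L"
    and x: "\<And>a. a < N \<Longrightarrow> x a \<in> multi_index d A"
    and y: "\<And>b. b < N \<Longrightarrow> y b \<in> multi_index d (L - A)"
    and minor: "flattening_minor A N x y t \<noteq> 0"
  shows "N \<le> flattening_rank d L A t"
proof (rule ccontr)
  assume less: "\<not> N \<le> flattening_rank d L A t"
  let ?n = "flattening_rank d L A t"
  obtain f g where f: "\<And>s. depends_on A (f s)" and g: "\<And>s. depends_on (L - A) (g s)"
    and t: "\<And>i. i \<in> multi_index d L \<Longrightarrow> t i = (\<Sum>s<?n. f s i * g s i)"
    using flattening_rank_decomposition[OF assms(1,2) order_refl, of d t] by metis
  \<comment> \<open>Zero columns pad \<open>U\<close> to a square matrix, so that multiplicativity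
    of the determinant applies. Column \<open>?n\<close> exists and is zero because
    \<open>?n < N\<close>.\<close>
  define U where "U = mat N N (\<lambda>(a, s). if s < ?n then f s (x a) else 0)"
  define V where "V = mat N N (\<lambda>(s, b). g s (y b))"
  have UV: "U \<in> carrier_mat N N" "V \<in> carrier_mat N N" by (auto simp: U_def V_def)
  have "mat N N (\<lambda>(a, b). t (override_on (y b) (x a) A)) = U * V"
  proof (rule eq_matI)
    fix a b assume "a < dim_row (U * V)" "b < dim_col (U * V)"
    then have ab: "a < N" "b < N" by (auto simp: U_def V_def)
    have "t (override_on (y b) (x a) A) = (\<Sum>s<?n. f s (x a) * g s (y b))"
    proof (subst t)
      show "override_on (y b) (x a) A \<in> multi_index d L"
        using ab x y assms(2) by (intro multi_index_override) auto
      show "(\<Sum>s<?n. f s (override_on (y b) (x a) A) * g s (override_on (y b) (x a) A))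
          = (\<Sum>s<?n. f s (x a) * g s (y b))"
        by (intro sum.cong refl arg_cong2[of _ _ _ _ "(*)"] depends_onD[OF f] depends_onD[OF g])
           (auto simp: override_on_def)
    qed
    also have "\<dots> = (\<Sum>s\<in>{0..<N}. (if s < ?n then f s (x a) else 0) * g s (y b))"
      using less by (intro sum.mono_neutral_cong_left) auto
    finally show "mat N N (\<lambda>(a, b). t (override_on (y b) (x a) A)) $$ (a, b) = (U * V) $$ (a, b)"
      using ab by (simp add: U_def V_def scalar_prod_def)
  qed (auto simp: U_def V_def)
  then have "flattening_minor A N x y t = Determinant.det U * Determinant.det V"
    unfolding flattening_minor_def using det_mult[OF UV] by simp
  moreover have "Determinant.det U = 0"
  proof -
    have "unit_vec N ?n \<in> carrier_vec N" "unit_vec N ?n \<noteq> (0\<^sub>v N :: complex vec)"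
      using less by (auto simp: vec_eq_iff intro!: exI[of _ ?n])
    moreover have "U *\<^sub>v unit_vec N ?n = 0\<^sub>v N"
      using less by (intro eq_vecI) (auto simp: U_def)
    ultimately show ?thesis using det_0_iff_vec_prod_zero[OF UV(1)] by blast
  qed
  ultimately show False using minor by simp
qed

text \<open>The open set is the nonzero locus of \<open>g\<close> in \<open>X\<close>. A
  neighbourhood of \<open>t\<^sub>0\<close> contains the nonzero locus in \<open>X\<close> of some
  \<open>p\<close> with \<open>p t\<^sub>0 \<noteq> 0\<close>; on the path to
  \<open>t\<^sub>1\<close> both \<open>p\<close> and \<open>g\<close> are polynomials in the
  parameter, nonzero at 0 and at 1 respectively, hence simultaneously nonzero somewhere.\<close>

lemma generically_polynomial_path:
  assumes "X \<subseteq> S" and "g \<in> polynomial_functions" and "t\<^sub>1 \<in> X" and "g t\<^sub>1 \<noteq> 0"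
    and path: "\<And>t\<^sub>0. t\<^sub>0 \<in> X \<Longrightarrow>
      \<exists>\<gamma>. (\<forall>i. poly_fun (\<lambda>s. \<gamma> s i)) \<and> \<gamma> 0 = t\<^sub>0 \<and> \<gamma> 1 = t\<^sub>1 \<and> (\<forall>s. \<gamma> s \<in> X)"
    and Q: "\<And>t. t \<in> X \<Longrightarrow> g t \<noteq> 0 \<Longrightarrow> Q t"
  shows "generically S X Q"
proof -
  define U where "U = {t \<in> X. g t \<noteq> 0}"
  have "openin (zariski S) (S - {x. \<forall>p\<in>{\<lambda>x. 1 :: complex}. p x = 0})"
    unfolding openin_zariski
    by (rule exI[of _ "{\<lambda>x. 1}"]) (auto intro: polynomial_functions.const)
  then have top: "topspace (zariski S) = S"
    using openin_subset by (fastforce simp: topspace_def openin_zariski)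
  have "openin (zariski S) (S - {x. \<forall>p\<in>{g}. p x = 0})"
    unfolding openin_zariski using assms(2) by (intro exI[of _ "{g}"]) simp
  moreover have "U = (S - {x. \<forall>p\<in>{g}. p x = 0}) \<inter> X" using assms(1) by (auto simp: U_def)
  ultimately have "openin (subtopology (zariski S) X) U" unfolding openin_subtopology by blast
  moreover have "subtopology (zariski S) X closure_of U = X"
  proof
    show "subtopology (zariski S) X closure_of U \<subseteq> X"
      using closure_of_subset_topspace[of "subtopology (zariski S) X" U] by auto
    show "X \<subseteq> subtopology (zariski S) X closure_of U"
    proof
      fix t\<^sub>0 assume t0: "t\<^sub>0 \<in> X"
      have "\<exists>t. t \<in> U \<and> t \<in> T" if T: "t\<^sub>0 \<in> T" "openin (subtopology (zariski S) X) T" for T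
      proof -
        obtain P where P: "P \<subseteq> polynomial_functions" "T = (S - {x. \<forall>p\<in>P. p x = 0}) \<inter> X"
          using T(2) unfolding openin_subtopology openin_zariski by blast
        then obtain p where p: "p \<in> P" "p t\<^sub>0 \<noteq> 0" using T(1) by auto
        obtain \<gamma> where \<gamma>: "\<And>i. poly_fun (\<lambda>s. \<gamma> s i)" "\<gamma> 0 = t\<^sub>0" "\<gamma> 1 = t\<^sub>1" "\<And>s. \<gamma> s \<in> X"
          using path[OF t0] by blast
        have "poly_fun (\<lambda>s. p (\<gamma> s))" "poly_fun (\<lambda>s. g (\<gamma> s))"
          using p(1) P(1) assms(2) by (auto intro: poly_fun_comp_polynomial_function \<gamma>(1))
        moreover have "p (\<gamma> 0) \<noteq> 0" "g (\<gamma> 1) \<noteq> 0" using p assms(4) \<gamma>(2,3) by auto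
        ultimately obtain s where "p (\<gamma> s) \<noteq> 0" "g (\<gamma> s) \<noteq> 0"
          by (rule poly_fun_common_nonzero)
        then have "\<gamma> s \<in> U" "\<gamma> s \<in> T"
          using \<gamma>(4)[of s] assms(1) p(1) unfolding U_def P(2) by auto
        then show ?thesis by blast
      qed
      then show "t\<^sub>0 \<in> subtopology (zariski S) X closure_of U"
        unfolding in_closure_of using t0 assms(1) top by (simp add: subset_iff)
    qed
  qed
  ultimately show ?thesis unfolding generically_def using Q by (auto simp: U_def)
qed

section \<open>Trees and cuts\<close>

lemma component_of_refl: "v \<in> component_of E v"
  by (simp add: component_of_def)

lemma component_of_edge: "{u, v} \<in> E \<Longrightarrow> v \<in> component_of E u"
  by (auto simp: component_of_def)

lemma component_of_trans: "v \<in> component_of E u \<Longrightarrow> w \<in> component_of E v \<Longrightarrow> w \<in> component_of E u"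
  unfolding component_of_def by (auto intro: rtrancl_trans)

lemma component_of_sym: "v \<in> component_of E u \<Longrightarrow> u \<in> component_of E v"
proof -
  have "sym {(x, y). {x, y} \<in> E}" by (auto simp: sym_def insert_commute)
  then show "v \<in> component_of E u \<Longrightarrow> u \<in> component_of E v"
    unfolding component_of_def using sym_rtrancl by (auto dest: symD)
qed

lemma component_of_eq: "v \<in> component_of E u \<Longrightarrow> component_of E v = component_of E u"
  using component_of_trans component_of_sym by (metis subset_antisym subsetI)

lemma component_of_subset:
  assumes "u \<in> S" and "\<And>a b. {a, b} \<in> E \<Longrightarrow> a \<in> S \<Longrightarrow> b \<in> S"
  shows "component_of E u \<subseteq> S"
proof
  fix w assume "w \<in> component_of E u"
  then have "(u, w) \<in> {(x, y). {x, y} \<in> E}\<^sup>*" by (simp add: component_of_def)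
  then show "w \<in> S" by induction (use assms in auto)
qed

lemma component_of_mono: "E \<subseteq> E' \<Longrightarrow> component_of E u \<subseteq> component_of E' u"
  unfolding component_of_def by (auto elim!: rtrancl_mono[THEN subsetD, rotated])

lemma component_of_isolated: "(\<And>e. e \<in> E \<Longrightarrow> v \<notin> e) \<Longrightarrow> component_of E v = {v}"
  using component_of_subset[of v "{v}" E] component_of_refl[of v E] by fastforce

lemma component_of_constant:
  assumes "\<And>a b. {a, b} \<in> E \<Longrightarrow> \<kappa> a = \<kappa> b" and "w \<in> component_of E u"
  shows "\<kappa> w = \<kappa> u"
  using component_of_subset[of u "{v. \<kappa> v = \<kappa> u}" E] assms by fastforce

text \<open>Provides the induction principle for all tree statements below;
  \<open>unrooted_tree_grown\<close> shows that every unrooted tree arises this way.\<close>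

inductive grown_tree :: "'v set \<Rightarrow> 'v set set \<Rightarrow> bool" where
  single: "grown_tree {v} {}"
| pendant: "grown_tree W E \<Longrightarrow> y \<in> W \<Longrightarrow> x \<notin> W \<Longrightarrow> grown_tree (insert x W) (insert {x, y} E)"

lemma grown_tree_finite: "grown_tree W E \<Longrightarrow> finite W \<and> finite E"
  by (induction rule: grown_tree.induct) auto

lemma grown_tree_edge: "grown_tree W E \<Longrightarrow> e \<in> E \<Longrightarrow> e \<noteq> {} \<and> e \<subseteq> W"
  by (induction rule: grown_tree.induct) auto

lemma grown_tree_edge_doubleton:
  "grown_tree W E \<Longrightarrow> e \<in> E \<Longrightarrow> u \<in> e \<Longrightarrow> v \<in> e \<Longrightarrow> u \<noteq> v \<Longrightarrow> e = {u, v}"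
proof (induction rule: grown_tree.induct)
  case (pendant W E y x)
  then show ?case by (cases "e \<in> E") fastforce+
qed simp

text \<open>The new vertex is reachable only through \<open>y\<close>. The edge set \<open>D\<close>
  is arbitrary inside \<open>W\<close>, so that the lemma also applies after deletion of an
  edge.\<close>

lemma component_of_pendant:
  assumes "\<And>e. e \<in> D \<Longrightarrow> e \<subseteq> W" and "u \<in> W" and "x \<notin> W"
  shows "component_of (insert {x, y} D) u
    = component_of D u \<union> (if y \<in> component_of D u then {x} else {})"
proof
  have W: "component_of D u \<subseteq> W"
    using assms(1,2) by (intro component_of_subset) auto
  show "component_of (insert {x, y} D) u
      \<subseteq> component_of D u \<union> (if y \<in> component_of D u then {x} else {})" (is "_ \<subseteq> ?S")
  proof (rule component_of_subset)
    fix a b assume ab: "{a, b} \<in> insert {x, y} D" "a \<in> ?S"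
    show "b \<in> ?S"
    proof (cases "{a, b} \<in> D")
      case True
      then have "a \<noteq> x" using assms(1)[OF True] assms(3) by auto
      then have "a \<in> component_of D u" using ab(2) by (auto split: if_splits)
      then have "b \<in> component_of D u" using True component_of_edge component_of_trans by metis
      then show ?thesis by simp
    next
      case False
      then have "a = x \<and> b = y \<or> a = y \<and> b = x" using ab(1) by (auto simp: doubleton_eq_iff)
      then show ?thesis using ab(2) W assms(3) by (auto split: if_splits)
    qed
  qed (simp add: component_of_refl)
  have sub: "component_of D u \<subseteq> component_of (insert {x, y} D) u"
    by (rule component_of_mono) auto
  have "x \<in> component_of (insert {x, y} D) u" if "y \<in> component_of D u"
  proof (rule component_of_trans)
    show "y \<in> component_of (insert {x, y} D) u" using that sub by blast
    show "x \<in> component_of (insert {x, y} D) y"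
      by (rule component_of_edge) (simp add: insert_commute)
  qed
  then show "?S \<subseteq> component_of (insert {x, y} D) u" using sub by auto
qed

lemma grown_tree_connected: "grown_tree W E \<Longrightarrow> u \<in> W \<Longrightarrow> component_of E u = W"
proof (induction arbitrary: u rule: grown_tree.induct)
  case (single v)
  then show ?case using component_of_isolated[of "{}" v] by simp
next
  case (pendant W E y x)
  have W: "component_of (insert {x, y} E) v = insert x W" if "v \<in> W" for v
    using component_of_pendant[of E W v x y] grown_tree_edge[OF pendant.hyps(1)] that pendant by auto
  show ?case
  proof (cases "u = x")
    case True
    then show ?thesis using W[OF pendant.hyps(2)] component_of_eq[of x "insert {x, y} E" y] by auto
  qed (use W pendant.prems in auto)
qed

lemma pendant_delete:
  assumes "grown_tree W E" and "x \<notin> W"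
  shows "insert {x, y} E - {{x, y}} = E" and "f \<in> E \<Longrightarrow> insert {x, y} E - {f} = insert {x, y} (E - {f})"
proof -
  have "{x, y} \<notin> E" using grown_tree_edge[OF assms(1), of "{x, y}"] assms(2) by auto
  then show "insert {x, y} E - {{x, y}} = E"
    and "f \<in> E \<Longrightarrow> insert {x, y} E - {f} = insert {x, y} (E - {f})" by auto
qed

text \<open>Root the tree at its initial vertex and let \<open>F e\<close> be the set of descendants
  below \<open>e\<close>. A new pendant edge gets \<open>{x}\<close>, and an old set gains
  \<open>x\<close> exactly if it contains the parent \<open>y\<close>; both operations keep the
  family laminar.\<close>

lemma grown_tree_laminar_sides:
  "grown_tree W E \<Longrightarrow> \<exists>F.
    (\<forall>e\<in>E. F e \<subseteq> W \<and> (\<forall>u\<in>e. component_of (E - {e}) u = F e \<or> component_of (E - {e}) u = W - F e)) \<and>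
    (\<forall>e\<in>E. \<forall>f\<in>E. F e \<subseteq> F f \<or> F f \<subseteq> F e \<or> F e \<inter> F f = {})"
proof (induction rule: grown_tree.induct)
  case (pendant W E y x)
  then obtain F where F: "\<And>e. e \<in> E \<Longrightarrow> F e \<subseteq> W"
    "\<And>e u. e \<in> E \<Longrightarrow> u \<in> e \<Longrightarrow> component_of (E - {e}) u = F e \<or> component_of (E - {e}) u = W - F e"
    "\<And>e f. e \<in> E \<Longrightarrow> f \<in> E \<Longrightarrow> F e \<subseteq> F f \<or> F f \<subseteq> F e \<or> F e \<inter> F f = {}" by metis
  note edge = grown_tree_edge[OF pendant.hyps(1)]
  note del = pendant_delete[OF pendant.hyps(1,3), where y = y]
  define F' where "F' f = (if f = {x, y} then {x} else if y \<in> F f then insert x (F f) else F f)" for f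
  have new: "{x, y} \<notin> E" using edge pendant.hyps(3) by auto
  show ?case
  proof (intro exI[of _ F'] conjI ballI)
    fix e assume e: "e \<in> insert {x, y} E"
    show "F' e \<subseteq> insert x W" using F(1) e by (auto simp: F'_def)
    fix u assume u: "u \<in> e"
    show "component_of (insert {x, y} E - {e}) u = F' e
        \<or> component_of (insert {x, y} E - {e}) u = insert x W - F' e"
    proof (cases "e = {x, y}")
      case True
      have "component_of E x = {x}" using edge pendant.hyps(3) by (intro component_of_isolated) auto
      moreover have "component_of E y = W" by (rule grown_tree_connected[OF pendant.hyps(1,2)])
      ultimately show ?thesis using True u del(1) pendant.hyps by (auto simp: F'_def)
    next
      case False
      then have eE: "e \<in> E" using e by simp
      then have "u \<in> W" using edge u by auto
      then have "component_of (insert {x, y} E - {e}) u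
          = component_of (E - {e}) u \<union> (if y \<in> component_of (E - {e}) u then {x} else {})"
        unfolding del(2)[OF eE] using edge pendant.hyps(3) by (intro component_of_pendant[where W = W]) auto
      then show ?thesis using F(1)[OF eE] F(2)[OF eE u] False pendant.hyps(2,3) by (auto simp: F'_def)
    qed
  next
    fix e f assume ef: "e \<in> insert {x, y} E" "f \<in> insert {x, y} E"
    have x: "x \<notin> F g" if "g \<in> E" for g using F(1)[OF that] pendant.hyps(3) by auto
    show "F' e \<subseteq> F' f \<or> F' f \<subseteq> F' e \<or> F' e \<inter> F' f = {}"
    proof (cases "e \<in> E \<and> f \<in> E")
      case True
      then have "e \<noteq> {x, y}" "f \<noteq> {x, y}" using new by auto
      then show ?thesis using F(3)[of e f] True x[of e] x[of f] unfolding F'_def by auto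
    qed (use ef in \<open>auto simp: F'_def\<close>)
  qed
qed auto

section \<open>Vertex colourings and their bichromatic edges\<close>

definition bichromatic :: "('v \<Rightarrow> bool) \<Rightarrow> 'v set \<Rightarrow> bool" where
  "bichromatic \<kappa> e \<longleftrightarrow> (\<exists>u\<in>e. \<exists>v\<in>e. \<kappa> u \<noteq> \<kappa> v)"

lemma bichromatic_cong: "(\<And>u. u \<in> e \<Longrightarrow> \<kappa> u = \<kappa>' u) \<Longrightarrow> bichromatic \<kappa> e = bichromatic \<kappa>' e"
  unfolding bichromatic_def by auto

lemma card_bichromatic_pendant:
  assumes "grown_tree W E" and "x \<notin> W" and "\<And>u. u \<in> W \<Longrightarrow> \<kappa> u = \<kappa>' u"
  shows "card {e \<in> insert {x, y} E. bichromatic \<kappa> e}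
    = card {e \<in> E. bichromatic \<kappa>' e} + (if \<kappa> x = \<kappa> y then 0 else 1)"
proof -
  have "bichromatic \<kappa> e = bichromatic \<kappa>' e" if "e \<in> E" for e
    using grown_tree_edge[OF assms(1) that] assms(3) by (intro bichromatic_cong) auto
  moreover have "bichromatic \<kappa> {x, y} \<longleftrightarrow> \<kappa> x \<noteq> \<kappa> y" by (auto simp: bichromatic_def)
  ultimately have "{e \<in> insert {x, y} E. bichromatic \<kappa> e}
      = {e \<in> E. bichromatic \<kappa>' e} \<union> (if \<kappa> x = \<kappa> y then {} else {{x, y}})"
    by auto
  moreover have "{x, y} \<notin> E" using grown_tree_edge[OF assms(1)] assms(2) by auto
  ultimately show ?thesis using grown_tree_finite[OF assms(1)] by auto
qed

text \<open>The rank enters only through an abstract \<open>\<rho>\<close> that is symmetric under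
  complements and submultiplicative. Moving the tokens at \<open>x\<close> to \<open>y\<close>
  leaves the colour class unchanged if \<open>x\<close> and \<open>y\<close> have the same colour.
  Otherwise the class changes by the set \<open>B\<close> of tokens at \<open>x\<close>, which is a
  side of the new edge: one factor \<open>r\<close> for one more bichromatic edge.\<close>

lemma grown_tree_colouring_bound:
  fixes \<rho> :: "'l set \<Rightarrow> nat"
  assumes empty: "\<rho> {} \<le> 1"
    and compl: "\<And>X. X \<subseteq> L \<Longrightarrow> \<rho> (L - X) = \<rho> X"
    and un: "\<And>X Y. X \<subseteq> L \<Longrightarrow> Y \<subseteq> L \<Longrightarrow> X \<inter> Y = {} \<Longrightarrow> \<rho> (X \<union> Y) \<le> \<rho> X * \<rho> Y"
  shows "grown_tree W E \<Longrightarrow> (\<And>l. l \<in> L \<Longrightarrow> loc l \<in> W) \<Longrightarrow>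
    (\<And>e u. e \<in> E \<Longrightarrow> u \<in> e \<Longrightarrow> \<rho> {l \<in> L. loc l \<in> component_of (E - {e}) u} \<le> r) \<Longrightarrow>
    \<rho> {l \<in> L. \<kappa> (loc l)} \<le> r ^ card {e \<in> E. bichromatic \<kappa> e}"
proof (induction arbitrary: loc \<kappa> rule: grown_tree.induct)
  case (single v)
  have "\<kappa> (loc l) = \<kappa> v" if "l \<in> L" for l using single.prems(1)[OF that] by simp
  then have "{l \<in> L. \<kappa> (loc l)} = (if \<kappa> v then L else {})" by auto
  then show ?case using empty compl[of "{}"] by simp
next
  case (pendant W E y x)
  note edge = grown_tree_edge[OF pendant.hyps(1)]
  note del = pendant_delete[OF pendant.hyps(1,3), where y = y]
  define loc' where "loc' l = (if loc l = x then y else loc l)" for l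
  have loc'_W: "loc' l \<in> W" if "l \<in> L" for l
    using pendant.prems(1)[OF that] pendant.hyps(2) by (auto simp: loc'_def)
  have IH: "\<rho> {l \<in> L. \<kappa> (loc' l)} \<le> r ^ card {e \<in> E. bichromatic \<kappa> e}"
  proof (rule pendant.IH[OF loc'_W])
    fix e u assume e: "e \<in> E" "u \<in> e"
    then have "u \<in> W" using edge by auto
    then have c: "component_of (insert {x, y} E - {e}) u
        = component_of (E - {e}) u \<union> (if y \<in> component_of (E - {e}) u then {x} else {})"
      unfolding del(2)[OF e(1)] using edge pendant.hyps(3) by (intro component_of_pendant[where W = W]) auto
    have "component_of (E - {e}) u \<subseteq> W"
      using edge \<open>u \<in> W\<close> by (intro component_of_subset) auto
    then have "loc' l \<in> component_of (E - {e}) u \<longleftrightarrow> loc l \<in> component_of (insert {x, y} E - {e}) u" for l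
      using c pendant.hyps(3) by (auto simp: loc'_def)
    then show "\<rho> {l \<in> L. loc' l \<in> component_of (E - {e}) u} \<le> r"
      using pendant.prems(2)[of e u] e by simp
  qed
  have card: "card {e \<in> insert {x, y} E. bichromatic \<kappa> e}
      = card {e \<in> E. bichromatic \<kappa> e} + (if \<kappa> x = \<kappa> y then 0 else 1)"
    by (intro card_bichromatic_pendant[OF pendant.hyps(1,3)]) simp
  show ?case
  proof (cases "\<kappa> x = \<kappa> y")
    case True
    then have "\<kappa> (loc l) = \<kappa> (loc' l)" for l by (simp add: loc'_def)
    then show ?thesis using IH card True by simp
  next
    case False
    define B where "B = {l \<in> L. loc l = x}"
    define X where "X = {l \<in> L. \<kappa> (loc l)}"
    define X' where "X' = {l \<in> L. \<kappa> (loc' l)}"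
    have "component_of E x = {x}" using edge pendant.hyps(3) by (intro component_of_isolated) auto
    then have B: "\<rho> B \<le> r" using pendant.prems(2)[of "{x, y}" x] del(1) by (simp add: B_def)
    have sub: "X \<subseteq> L" "X' \<subseteq> L" "B \<subseteq> L" by (auto simp: X_def X'_def B_def)
    have "\<rho> X \<le> \<rho> X' * \<rho> B"
    proof (cases "\<kappa> x")
      case True
      then have "X = X' \<union> B" "X' \<inter> B = {}" using False by (auto simp: X_def X'_def B_def loc'_def)
      then show ?thesis using un sub by metis
    next
      case c: False
      \<comment> \<open>Here the token set \<open>B\<close> leaves the colour class; taking
        complements turns this into a disjoint union.\<close>
      then have "L - X = (L - X') \<union> B" "(L - X') \<inter> B = {}"
        using False by (auto simp: X_def X'_def B_def loc'_def)
      then have "\<rho> (L - X) \<le> \<rho> (L - X') * \<rho> B" using un[of "L - X'" B] sub by auto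
      then show ?thesis using compl sub by simp
    qed
    also have "\<dots> \<le> r ^ card {e \<in> E. bichromatic \<kappa> e} * r"
      using IH B unfolding X'_def by (rule mult_mono) auto
    finally show ?thesis using card False by (simp add: X_def mult.commute)
  qed
qed

section \<open>Max-flow min-cut on trees\<close>

text \<open>
  A set of pairs stands for a family of edge-disjoint paths between the tokens of the two kinds:
  every edge separates at most one pair. The colouring is a cut of the same capacity, where a
  wrongly coloured token counts as one cut edge.
\<close>

definition max_flow_min_cut ::
  "'v set set \<Rightarrow> 'l set \<Rightarrow> 'l set \<Rightarrow> ('l \<Rightarrow> 'v) \<Rightarrow> ('l \<times> 'l) set \<Rightarrow> ('v \<Rightarrow> bool) \<Rightarrow> bool" where
  "max_flow_min_cut E P N loc M \<kappa> \<longleftrightarrow>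
     M \<subseteq> P \<times> N \<and> inj_on fst M \<and> inj_on snd M \<and>
     (\<forall>e\<in>E. \<forall>m\<in>M. \<forall>m'\<in>M. loc (snd m) \<notin> component_of (E - {e}) (loc (fst m)) \<longrightarrow>
        loc (snd m') \<notin> component_of (E - {e}) (loc (fst m')) \<longrightarrow> m = m') \<and>
     card M = card {e \<in> E. bichromatic \<kappa> e} + card {p \<in> P. \<not> \<kappa> (loc p)} + card {n \<in> N. \<kappa> (loc n)}"

lemma max_flow_min_cut_swap:
  assumes "max_flow_min_cut E P N loc M \<kappa>"
  shows "max_flow_min_cut E N P loc (prod.swap ` M) (\<lambda>v. \<not> \<kappa> v)"
proof -
  have "card (prod.swap ` M) = card M" by (rule card_image) auto
  moreover have "inj_on fst (prod.swap ` M)" "inj_on snd (prod.swap ` M)"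
    using assms unfolding max_flow_min_cut_def inj_on_def by auto
  moreover have "bichromatic (\<lambda>v. \<not> \<kappa> v) = bichromatic \<kappa>" by (auto simp: bichromatic_def fun_eq_iff)
  moreover have "prod.swap ` M \<subseteq> N \<times> P" using assms unfolding max_flow_min_cut_def by auto
  moreover have "m = m'" if e: "e \<in> E" and m: "m \<in> prod.swap ` M" "m' \<in> prod.swap ` M"
    and sep: "loc (snd m) \<notin> component_of (E - {e}) (loc (fst m))"
    "loc (snd m') \<notin> component_of (E - {e}) (loc (fst m'))" for e m m'
  proof -
    obtain k k' where k: "k \<in> M" "k' \<in> M" "m = prod.swap k" "m' = prod.swap k'" using m by auto
    then have "loc (snd k) \<notin> component_of (E - {e}) (loc (fst k))"
      "loc (snd k') \<notin> component_of (E - {e}) (loc (fst k'))"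
      using sep component_of_sym[of _ "E - {e}"] by auto
    then have "k = k'" using assms k(1,2) e unfolding max_flow_min_cut_def by blast
    then show ?thesis using k by simp
  qed
  ultimately show ?thesis using assms unfolding max_flow_min_cut_def by auto
qed

lemma matching_exists:
  assumes "finite N" "finite P" "card N \<le> card P"
  obtains M where "M \<subseteq> P \<times> N" "inj_on fst M" "inj_on snd M" "card M = card N"
proof -
  obtain f where f: "inj_on f N" "f ` N \<subseteq> P" using assms by (meson card_le_inj)
  show thesis
  proof
    show "(\<lambda>n. (f n, n)) ` N \<subseteq> P \<times> N" using f by auto
    show "inj_on fst ((\<lambda>n. (f n, n)) ` N)" "inj_on snd ((\<lambda>n. (f n, n)) ` N)"
      using f by (auto simp: inj_on_def)
    show "card ((\<lambda>n. (f n, n)) ` N) = card N" by (rule card_image) (auto simp: inj_on_def)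
  qed
qed

text \<open>Tokens at \<open>x\<close> are paired on the spot as far as possible. By
  \<open>le\<close> any surplus is of kind \<open>P\<close>; only one surplus token can use the edge
  to \<open>y\<close>, since an edge may separate at most one pair. The remaining ones stay
  unpaired, and the induction hypothesis handles the rest.\<close>

lemma max_flow_min_cut_pendant:
  assumes grown: "grown_tree W E" and y: "y \<in> W" and x: "x \<notin> W"
    and IH: "\<And>(P :: 'l set) N loc. finite P \<Longrightarrow> finite N \<Longrightarrow> loc ` (P \<union> N) \<subseteq> W \<Longrightarrow>
      \<exists>M \<kappa>. max_flow_min_cut E P N loc M \<kappa>"
    and fin: "finite (P :: 'l set)" "finite N" and loc: "loc ` (P \<union> N) \<subseteq> insert x W"
    and le: "card {n \<in> N. loc n = x} \<le> card {p \<in> P. loc p = x}"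
  shows "\<exists>M \<kappa>. max_flow_min_cut (insert {x, y} E) P N loc M \<kappa>"
proof -
  note edge = grown_tree_edge[OF grown]
  note del = pendant_delete[OF grown x, where y = y]
  define Px where "Px = {p \<in> P. loc p = x}"
  define Nx where "Nx = {n \<in> N. loc n = x}"
  have finx: "finite Px" "finite Nx" "card Nx \<le> card Px" using fin le by (auto simp: Px_def Nx_def)
  \<comment> \<open>\<open>T\<close> consists of one surplus token, if there is one; it travels through the new edge.\<close>
  obtain T where T: "T \<subseteq> Px" "card T \<le> 1" "card Nx + card T \<le> card Px" "T = {} \<Longrightarrow> card Nx = card Px"
  proof (cases "card Nx = card Px")
    case True
    then show thesis using that[of "{}"] by simp
  next
    case False
    then have "Px \<noteq> {}" using finx by auto
    then obtain p where "p \<in> Px" by auto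
    then show thesis using that[of "{p}"] False finx by auto
  qed
  have finT: "finite T" using T(1) finx(1) by (rule finite_subset)
  define loc' where "loc' l = (if loc l = x then y else loc l)" for l
  define P' where "P' = (P - Px) \<union> T"
  define N' where "N' = N - Nx"
  have "loc' ` (P' \<union> N') \<subseteq> W"
    using loc y T(1) by (auto simp: loc'_def P'_def N'_def Px_def Nx_def)
  moreover have "finite P'" "finite N'" using fin finT by (auto simp: P'_def N'_def)
  ultimately obtain M' \<kappa>' where mf: "max_flow_min_cut E P' N' loc' M' \<kappa>'"
    using IH[of P' N' loc'] by blast
  have M': "M' \<subseteq> P' \<times> N'" "inj_on fst M'" "inj_on snd M'"
    using mf unfolding max_flow_min_cut_def by simp_all
  have sep': "\<And>e m m'. e \<in> E \<Longrightarrow> m \<in> M' \<Longrightarrow> m' \<in> M' \<Longrightarrow>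
        loc' (snd m) \<notin> component_of (E - {e}) (loc' (fst m)) \<Longrightarrow>
        loc' (snd m') \<notin> component_of (E - {e}) (loc' (fst m')) \<Longrightarrow> m = m'"
    using mf unfolding max_flow_min_cut_def by blast
  have card': "card M' = card {e \<in> E. bichromatic \<kappa>' e} + card {p \<in> P'. \<not> \<kappa>' (loc' p)}
        + card {n \<in> N'. \<kappa>' (loc' n)}"
    using mf unfolding max_flow_min_cut_def by simp
  have "card Nx \<le> card (Px - T)" using T(1,3) finT by (simp add: card_Diff_subset)
  then obtain Mx where Mx: "Mx \<subseteq> (Px - T) \<times> Nx" "inj_on fst Mx" "inj_on snd Mx" "card Mx = card Nx"
    using matching_exists[of Nx "Px - T"] finx by auto
  define M where "M = M' \<union> Mx"
  \<comment> \<open>With a surplus, \<open>x\<close> gets the colour right for \<open>P\<close>: the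
    new edge is then bichromatic exactly when the travelling token counted as miscoloured at
    \<open>y\<close>. Without one, \<open>x\<close> copies \<open>y\<close>; as
    \<open>card Px = card Nx\<close>, either colour miscolours exactly as many tokens as there are
    pairs in \<open>Mx\<close>.\<close>
  define \<kappa> where "\<kappa> = \<kappa>'(x := (T \<noteq> {} \<or> \<kappa>' y))"
  have finM: "finite M'" "finite Mx"
    using finite_subset[OF M'(1)] finite_subset[OF Mx(1)] finx \<open>finite P'\<close> \<open>finite N'\<close> by auto
  have disj: "fst ` M' \<inter> fst ` Mx = {}" "snd ` M' \<inter> snd ` Mx = {}"
    using M'(1) Mx(1) by (fastforce simp: P'_def N'_def)+
  have inj: "inj_on fst M" "inj_on snd M"
    using M'(2,3) Mx(2,3) disj unfolding M_def inj_on_Un by blast+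
  have sub: "M \<subseteq> P \<times> N"
    using M'(1) Mx(1) T(1) unfolding M_def by (fastforce simp: P'_def N'_def Px_def Nx_def)
  have Mx_loc: "loc (fst m) = x \<and> loc (snd m) = x" if "m \<in> Mx" for m
    using Mx(1) that by (auto simp: Px_def Nx_def)
  have sep: "m = m'" if e: "e \<in> insert {x, y} E" and m: "m \<in> M" "m' \<in> M"
    and s: "loc (snd m) \<notin> component_of (insert {x, y} E - {e}) (loc (fst m))"
    and s': "loc (snd m') \<notin> component_of (insert {x, y} E - {e}) (loc (fst m'))" for e m m'
  proof -
    \<comment> \<open>Both ends of a pair in \<open>Mx\<close> sit at \<open>x\<close>, so no edge
      separates it.\<close>
    have mM': "m \<in> M'" "m' \<in> M'"
      using m Mx_loc s s' component_of_refl unfolding M_def by (metis Un_iff)+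
    show ?thesis
    proof (cases "e = {x, y}")
      case True
      \<comment> \<open>The new edge can separate only the pair of the travelling token, because all
        other pairs from \<open>M'\<close> lie within the connected \<open>W\<close>.\<close>
      have "fst k \<in> T" if "k \<in> M'" "loc (snd k) \<notin> component_of E (loc (fst k))" for k
      proof (rule ccontr)
        assume "fst k \<notin> T"
        then have "loc (fst k) \<in> W" "loc (snd k) \<in> W"
          using that(1) M'(1) loc by (force simp: P'_def N'_def Px_def Nx_def)+
        then show False using that(2) grown_tree_connected[OF grown] by auto
      qed
      then have "fst m \<in> T" "fst m' \<in> T" using mM' s s' unfolding True del(1) by auto
      then have "fst m = fst m'" using T(2) finT card_le_Suc0_iff_eq[of T] by auto
      then show ?thesis using M'(2) mM' by (auto dest: inj_onD)
    next
      case False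
      then have eE: "e \<in> E" using e by simp
      \<comment> \<open>Deleting an old edge leaves \<open>x\<close> joined to \<open>y\<close>, so
        moving tokens between them preserves separation.\<close>
      have "loc' (snd k) \<notin> component_of (E - {e}) (loc' (fst k))"
        if "loc (snd k) \<notin> component_of (insert {x, y} E - {e}) (loc (fst k))" for k
      proof
        assume "loc' (snd k) \<in> component_of (E - {e}) (loc' (fst k))"
        then have c: "loc' (snd k) \<in> component_of (insert {x, y} E - {e}) (loc' (fst k))"
          unfolding del(2)[OF eE] using component_of_mono[of "E - {e}"] by blast
        have "x \<in> component_of (insert {x, y} E - {e}) y"
          unfolding del(2)[OF eE] by (rule component_of_edge) (simp add: insert_commute)
        then have "loc l \<in> component_of (insert {x, y} E - {e}) (loc' l)" for l
          unfolding loc'_def using component_of_refl by auto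
        then show False using that c component_of_trans component_of_sym by metis
      qed
      then show ?thesis using sep'[OF eE mM'] s s' by blast
    qed
  qed
  have "{p \<in> P. \<not> \<kappa> (loc p)} = {p \<in> P - Px. \<not> \<kappa>' (loc p)} \<union> (if \<kappa> x then {} else Px)"
    by (auto simp: \<kappa>_def Px_def)
  moreover have "{p \<in> P - Px. \<not> \<kappa>' (loc p)} \<inter> Px = {}" by auto
  ultimately have P_card: "card {p \<in> P. \<not> \<kappa> (loc p)}
      = card {p \<in> P - Px. \<not> \<kappa>' (loc p)} + (if \<kappa> x then 0 else card Px)"
    using fin(1) finx(1) by (simp add: card_Un_disjoint)
  have "{n \<in> N. \<kappa> (loc n)} = {n \<in> N'. \<kappa>' (loc' n)} \<union> (if \<kappa> x then Nx else {})"
    by (auto simp: \<kappa>_def N'_def Nx_def loc'_def)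
  moreover have "{n \<in> N'. \<kappa>' (loc' n)} \<inter> Nx = {}" by (auto simp: N'_def)
  ultimately have N_card: "card {n \<in> N. \<kappa> (loc n)}
      = card {n \<in> N'. \<kappa>' (loc' n)} + (if \<kappa> x then card Nx else 0)"
    using fin(2) finx(2) by (simp add: card_Un_disjoint N'_def)
  have "{p \<in> P'. \<not> \<kappa>' (loc' p)} = {p \<in> P - Px. \<not> \<kappa>' (loc p)} \<union> (if \<kappa>' y then {} else T)"
    using T(1) by (auto simp: P'_def Px_def loc'_def)
  moreover have "{p \<in> P - Px. \<not> \<kappa>' (loc p)} \<inter> T = {}" using T(1) by auto
  ultimately have P'_card: "card {p \<in> P'. \<not> \<kappa>' (loc' p)}
      = card {p \<in> P - Px. \<not> \<kappa>' (loc p)} + (if \<kappa>' y then 0 else card T)"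
    using fin(1) finT by (simp add: card_Un_disjoint)
  have xy: "\<kappa> y = \<kappa>' y" using x y by (auto simp: \<kappa>_def)
  have "card {e \<in> insert {x, y} E. bichromatic \<kappa> e}
    = card {e \<in> E. bichromatic \<kappa>' e} + (if \<kappa> x = \<kappa> y then 0 else 1)"
    using x by (intro card_bichromatic_pendant[OF grown x]) (auto simp: \<kappa>_def)
  moreover have "card M = card M' + card Nx"
    unfolding M_def using finM disj(1) Mx(4) by (subst card_Un_disjoint) auto
  moreover have "T \<noteq> {} \<Longrightarrow> card T = 1"
    using T(2) finT card_gt_0_iff[of T] by auto
  moreover have "\<kappa> x = (T \<noteq> {} \<or> \<kappa>' y)" by (simp add: \<kappa>_def)
  ultimately have "card M = card {e \<in> insert {x, y} E. bichromatic \<kappa> e}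
      + card {p \<in> P. \<not> \<kappa> (loc p)} + card {n \<in> N. \<kappa> (loc n)}"
    using card' P_card N_card P'_card T(4) xy by (cases "T = {}") auto
  then have "max_flow_min_cut (insert {x, y} E) P N loc M \<kappa>"
    unfolding max_flow_min_cut_def using sub inj sep by blast
  then show ?thesis by blast
qed

lemma grown_tree_max_flow_min_cut:
  "grown_tree W E \<Longrightarrow> finite P \<Longrightarrow> finite N \<Longrightarrow> loc ` (P \<union> N) \<subseteq> W \<Longrightarrow>
     \<exists>M \<kappa>. max_flow_min_cut E (P :: 'l set) N loc M \<kappa>"
proof (induction arbitrary: P N loc rule: grown_tree.induct)
  case (single v)
  have *: "\<exists>M \<kappa>. max_flow_min_cut {} P N loc M \<kappa>"
    if c: "card N \<le> card P" "finite P" "finite N" for P N :: "'l set"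
  proof -
    obtain M where "M \<subseteq> P \<times> N" "inj_on fst M" "inj_on snd M" "card M = card N"
      using matching_exists[OF c(3,2,1)] by blast
    \<comment> \<open>With the only vertex coloured \<open>True\<close>, precisely the tokens in
      \<open>N\<close> are miscoloured, and \<open>card M = card N\<close>.\<close>
    then have "max_flow_min_cut {} P N loc M (\<lambda>v. True)" by (simp add: max_flow_min_cut_def)
    then show ?thesis by blast
  qed
  show ?case
  proof (cases "card N \<le> card P")
    case False
    then have "\<exists>M \<kappa>. max_flow_min_cut {} N P loc M \<kappa>" using *[of P N] single.prems(1,2) by simp
    then show ?thesis using max_flow_min_cut_swap by blast
  qed (use *[of N P] single.prems(1,2) in simp)
next
  case (pendant W E y x)
  show ?case
  proof (cases "card {n \<in> N. loc n = x} \<le> card {p \<in> P. loc p = x}")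
    case True
    show ?thesis
      by (rule max_flow_min_cut_pendant[OF pendant.hyps pendant.IH pendant.prems True])
  next
    case False
    have "\<exists>M \<kappa>. max_flow_min_cut (insert {x, y} E) N P loc M \<kappa>"
    proof (rule max_flow_min_cut_pendant[OF pendant.hyps pendant.IH])
      show "loc ` (N \<union> P) \<subseteq> insert x W" using pendant.prems(3) by (simp add: Un_commute)
    qed (use pendant.prems(1,2) False in simp_all)
    then show ?thesis using max_flow_min_cut_swap by blast
  qed
qed

section \<open>Connected acyclic graphs grow by pendant vertices\<close>

lemma grown_tree_path:
  "grown_tree W E \<Longrightarrow> u \<in> W \<Longrightarrow> v \<in> W \<Longrightarrow>
     \<exists>p. p \<noteq> [] \<and> hd p = u \<and> last p = v \<and> distinct p \<and> set p \<subseteq> W \<and> successively (\<lambda>a b. {a, b} \<in> E) p"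
proof (induction arbitrary: u v rule: grown_tree.induct)
  case (single w)
  then show ?case by (intro exI[of _ "[w]"]) auto
next
  case (pendant W E y x)
  have mono: "successively (\<lambda>a b. {a, b} \<in> insert {x, y} E) p" if "successively (\<lambda>a b. {a, b} \<in> E) p" for p
    using that by (rule successively_mono) auto
  consider "u = x" "v = x" | "u = x" "v \<in> W" | "u \<in> W" "v = x" | "u \<in> W" "v \<in> W"
    using pendant.prems by auto
  then show ?case
  proof cases
    case 1
    then show ?thesis by (intro exI[of _ "[x]"]) auto
  next
    case 2
    then obtain p where "p \<noteq> []" "hd p = y" "last p = v" "distinct p" "set p \<subseteq> W"
      "successively (\<lambda>a b. {a, b} \<in> E) p" using pendant.IH pendant.hyps(2) by blast
    then show ?thesis using 2 pendant.hyps(3) mono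
      by (intro exI[of _ "x # p"]) (auto simp: successively_Cons)
  next
    case 3
    then obtain p where "p \<noteq> []" "hd p = u" "last p = y" "distinct p" "set p \<subseteq> W"
      "successively (\<lambda>a b. {a, b} \<in> E) p" using pendant.IH pendant.hyps(2) by blast
    then show ?thesis using 3 pendant.hyps(3) mono
      by (intro exI[of _ "p @ [x]"]) (auto simp: successively_append_iff insert_commute)
  next
    case 4
    then obtain p where "p \<noteq> []" "hd p = u" "last p = v" "distinct p" "set p \<subseteq> W"
      "successively (\<lambda>a b. {a, b} \<in> E) p" using pendant.IH by blast
    then show ?thesis using mono by (intro exI[of _ p]) auto
  qed
qed

lemma graph_cycle_closed_path:
  assumes "successively (\<lambda>a b. {a, b} \<in> E) p" "distinct p" "length p \<ge> 3" "{last p, hd p} \<in> E"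
  shows "graph_cycle E p"
  unfolding graph_cycle_def
proof (intro conjI allI impI)
  fix i assume i: "i < length p"
  show "{p ! i, p ! (Suc i mod length p)} \<in> E"
  proof (cases "Suc i < length p")
    case True
    then show ?thesis using assms(1) by (simp add: successively_conv_nth)
  next
    case False
    then have "i = length p - 1" "p \<noteq> []" "Suc i mod length p = 0" using i by (auto simp: mod_eq_0_iff_dvd not_less le_Suc_eq)
    then show ?thesis using assms(4) by (simp add: last_conv_nth hd_conv_nth)
  qed
qed (use assms in auto)

text \<open>Take a maximal vertex set whose induced subgraph is grown. If it is proper,
  connectedness yields an edge to some \<open>x\<close> outside; a second edge from \<open>x\<close>
  into the set would close a cycle with the path joining the two ends inside. Hence \<open>x\<close>
  is pendant, against maximality.\<close>

lemma unrooted_tree_grown: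
  assumes "unrooted_tree W E"
  shows "grown_tree W E"
proof -
  have fin: "finite W" and edges: "\<And>e. e \<in> E \<Longrightarrow> \<exists>u v. e = {u, v} \<and> u \<in> W \<and> v \<in> W \<and> u \<noteq> v"
    and "W \<noteq> {}" and conn: "\<And>u v. u \<in> W \<Longrightarrow> v \<in> W \<Longrightarrow> v \<in> component_of E u"
    and acyclic: "\<And>p. \<not> graph_cycle E p"
    using assms unfolding unrooted_tree_def simple_graph_def connected_graph_def by blast+
  define good where "good S \<longleftrightarrow> S \<subseteq> W \<and> grown_tree S {e \<in> E. e \<subseteq> S}" for S
  obtain v where v: "v \<in> W" using \<open>W \<noteq> {}\<close> by auto
  have "{e \<in> E. e \<subseteq> {v}} = {}" using edges by fastforce
  then have "grown_tree {v} {e \<in> E. e \<subseteq> {v}}" by (simp only: grown_tree.single)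
  then have "good {v}" using v by (simp add: good_def)
  moreover have "finite {S. good S}"
    using fin by (rule finite_subset[rotated, OF finite_Pow_iff[THEN iffD2]]) (auto simp: good_def)
  ultimately obtain S where S: "good S" and max: "\<And>S'. good S' \<Longrightarrow> S \<subseteq> S' \<Longrightarrow> S' = S"
    using finite_has_maximal[of "{S. good S}"] by (metis empty_iff mem_Collect_eq)
  have grown: "grown_tree S {e \<in> E. e \<subseteq> S}" and SW: "S \<subseteq> W" using S by (auto simp: good_def)
  have "S = W"
  proof (rule ccontr)
    assume "S \<noteq> W"
    then obtain w where w: "w \<in> W" "w \<notin> S" using SW by auto
    have "S \<noteq> {}" using grown by (cases rule: grown_tree.cases) auto
    then obtain s where s: "s \<in> S" by auto
    have "\<not> component_of E s \<subseteq> S" using conn[of s w] w s SW by auto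
    then obtain y x where xy: "{y, x} \<in> E" "y \<in> S" "x \<notin> S"
      using component_of_subset[of s S E] s by blast
    have xW: "x \<in> W" using edges[OF xy(1)] by (auto simp: doubleton_eq_iff)
    have "e = {x, y}" if e: "e \<in> E" "e \<subseteq> insert x S" "\<not> e \<subseteq> S" for e
    proof (rule ccontr)
      assume ne: "e \<noteq> {x, y}"
      obtain z where z: "e = {x, z}" "z \<in> S" using edges[OF e(1)] e(2,3) by (auto simp: insert_commute)
      then have "z \<noteq> y" using ne by auto
      obtain p where p: "p \<noteq> []" "hd p = z" "last p = y" "distinct p" "set p \<subseteq> S"
        "successively (\<lambda>a b. {a, b} \<in> {e \<in> E. e \<subseteq> S}) p"
        using grown_tree_path[OF grown z(2) xy(2)] by blast
      have "successively (\<lambda>a b. {a, b} \<in> E) p" using p(6) by (rule successively_mono) auto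
      then have "successively (\<lambda>a b. {a, b} \<in> E) (p @ [x])"
        using p xy(1) by (auto simp: successively_append_iff)
      moreover have "length (p @ [x]) \<ge> 3"
      proof -
        have "length p \<noteq> 1" using p(2,3) \<open>z \<noteq> y\<close> by (auto simp: length_Suc_conv)
        then show ?thesis using p(1) by (cases p) (auto simp: Suc_le_eq)
      qed
      ultimately have "graph_cycle E (p @ [x])"
        using p xy(3) e(1) z by (intro graph_cycle_closed_path) auto
      then show False using acyclic by blast
    qed
    then have "{e \<in> E. e \<subseteq> insert x S} \<subseteq> insert {x, y} {e \<in> E. e \<subseteq> S}" by blast
    moreover have "{x, y} \<in> E" using xy(1) by (simp add: insert_commute)
    ultimately have "{e \<in> E. e \<subseteq> insert x S} = insert {x, y} {e \<in> E. e \<subseteq> S}"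
      using xy(2) by blast
    then have "good (insert x S)"
      using grown_tree.pendant[OF grown xy(2,3)] xW SW by (simp add: good_def)
    then show False using max[of "insert x S"] xy(3) by auto
  qed
  moreover have "{e \<in> E. e \<subseteq> W} = E" using edges by blast
  ultimately show ?thesis using grown by simp
qed

section \<open>Monochromatic cuts and vertex colourings\<close>

text \<open>Cutting the bichromatic edges and the edges at all miscoloured leaves is a monochromatic
  cut: miscoloured leaves become isolated, and elsewhere the colour is constant on components.
  Degree at most 1 bounds the price of each miscoloured leaf by one edge.\<close>

lemma minmono_le_colouring:
  assumes grown: "grown_tree W E" and A: "A \<subseteq> leaves W E"
  shows "minmono W E A \<le> card {e \<in> E. bichromatic \<kappa> e} + card {p \<in> A. \<not> \<kappa> p}
    + card {n \<in> leaves W E - A. \<kappa> n}"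
proof -
  let ?L = "leaves W E"
  define P where "P = {p \<in> A. \<not> \<kappa> p}"
  define N where "N = {n \<in> ?L - A. \<kappa> n}"
  define C where "C = {e \<in> E. bichromatic \<kappa> e} \<union> (\<Union>v\<in>P \<union> N. {e \<in> E. v \<in> e})"
  have fin: "finite W" "finite E" using grown_tree_finite[OF grown] by auto
  have PN: "P \<union> N \<subseteq> ?L" using A by (auto simp: P_def N_def)
  then have finPN: "finite (P \<union> N)"
    using fin(1) finite_subset[of "P \<union> N" W] by (auto simp: leaves_def)
  have "card (\<Union>v\<in>P \<union> N. {e \<in> E. v \<in> e}) \<le> (\<Sum>v\<in>P \<union> N. card {e \<in> E. v \<in> e})"
    using finPN by (rule card_UN_le)
  also have "\<dots> \<le> (\<Sum>v\<in>P \<union> N. 1)"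
    using PN by (intro sum_mono) (auto simp: leaves_def vertex_degree_def)
  also have "\<dots> \<le> card P + card N" using card_Un_le[of P N] by simp
  finally have "card C \<le> card {e \<in> E. bichromatic \<kappa> e} + (card P + card N)"
    unfolding C_def using card_Un_le[of "{e \<in> E. bichromatic \<kappa> e}"] by (meson add_left_mono le_trans)
  moreover have "monochromatic_cut W E A C"
    unfolding monochromatic_cut_def
  proof (intro conjI ballI)
    show "C \<subseteq> E" by (auto simp: C_def)
    fix v assume "v \<in> W"
    show "component_of (E - C) v \<inter> ?L \<subseteq> A \<or> component_of (E - C) v \<inter> ?L \<inter> A = {}"
    proof (rule ccontr)
      assume "\<not> ?thesis"
      then obtain a b where a: "a \<in> component_of (E - C) v" "a \<in> ?L" "a \<notin> A"
        and b: "b \<in> component_of (E - C) v" "b \<in> A" by blast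
      have single: "component_of (E - C) v = {l}" if "l \<in> component_of (E - C) v" "l \<in> P \<union> N" for l
      proof -
        have "component_of (E - C) l = {l}"
          by (rule component_of_isolated) (use that(2) in \<open>auto simp: C_def\<close>)
        then show ?thesis using component_of_eq[OF that(1)] by simp
      qed
      have "a \<noteq> b" using a b by auto
      then have "a \<notin> P \<union> N" "b \<notin> P \<union> N" using single[of a] single[of b] a(1) b(1) by auto
      then have "\<not> \<kappa> a" "\<kappa> b" using a b by (auto simp: P_def N_def)
      have const: "\<kappa> x = \<kappa> y" if "{x, y} \<in> E - C" for x y
      proof -
        have "\<not> bichromatic \<kappa> {x, y}" using that by (simp add: C_def)
        then show ?thesis unfolding bichromatic_def by blast
      qed
      have "\<kappa> a = \<kappa> v" "\<kappa> b = \<kappa> v"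
        using component_of_constant[where E = "E - C" and \<kappa> = \<kappa>, OF const] a(1) b(1) by blast+
      with \<open>\<not> \<kappa> a\<close> \<open>\<kappa> b\<close> show False by simp
    qed
  qed
  then have "\<exists>C'. monochromatic_cut W E A C' \<and> card C' = card C" by blast
  then have "minmono W E A \<le> card C" unfolding minmono_def by (rule Least_le)
  ultimately show ?thesis by (simp add: P_def N_def)
qed

text \<open>A vertex is coloured by whether its component after a minimum cut meets
  \<open>A\<close>. The colouring is constant on components, so every bichromatic edge belongs to
  the cut.\<close>

lemma minmono_colouring:
  assumes grown: "grown_tree W E" and A: "A \<subseteq> leaves W E"
  obtains \<kappa> where "\<And>l. l \<in> leaves W E \<Longrightarrow> \<kappa> l \<longleftrightarrow> l \<in> A"
    and "card {e \<in> E. bichromatic \<kappa> e} \<le> minmono W E A"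
proof -
  \<comment> \<open>Cutting all edges is monochromatic, hence the minimum in \<open>minmono\<close>
    is attained.\<close>
  have "component_of (E - E) v = {v}" for v by (rule component_of_isolated) simp
  then have "monochromatic_cut W E A E" by (auto simp: monochromatic_cut_def)
  then have "\<exists>k C. monochromatic_cut W E A C \<and> card C = k" by blast
  then have "\<exists>C. monochromatic_cut W E A C \<and> card C = minmono W E A"
    unfolding minmono_def by (rule LeastI_ex)
  then obtain C where C: "monochromatic_cut W E A C" "card C = minmono W E A" by blast
  define \<kappa> where "\<kappa> v \<longleftrightarrow> component_of (E - C) v \<inter> A \<noteq> {}" for v
  show thesis
  proof (rule that)
    fix l assume l: "l \<in> leaves W E"
    then have "component_of (E - C) l \<inter> leaves W E \<subseteq> A \<or> component_of (E - C) l \<inter> leaves W E \<inter> A = {}"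
      using C(1) by (auto simp: monochromatic_cut_def leaves_def)
    then show "\<kappa> l \<longleftrightarrow> l \<in> A" using l A component_of_refl[of l "E - C"] by (auto simp: \<kappa>_def)
  next
    have "{e \<in> E. bichromatic \<kappa> e} \<subseteq> C"
    proof
      fix e assume "e \<in> {e \<in> E. bichromatic \<kappa> e}"
      then obtain u v where e: "e \<in> E" "u \<in> e" "v \<in> e" "\<kappa> u \<noteq> \<kappa> v" by (auto simp: bichromatic_def)
      then have uv: "e = {u, v}" by (intro grown_tree_edge_doubleton[OF grown]) auto
      show "e \<in> C"
      proof (rule ccontr)
        assume "e \<notin> C"
        then have "component_of (E - C) v = component_of (E - C) u"
          using e(1) uv by (intro component_of_eq component_of_edge) auto
        then show False using e(4) by (simp add: \<kappa>_def)
      qed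
    qed
    moreover have "finite C"
      using C(1) grown_tree_finite[OF grown] by (auto simp: monochromatic_cut_def intro: finite_subset)
    ultimately show "card {e \<in> E. bichromatic \<kappa> e} \<le> minmono W E A" using C(2) card_mono by metis
  qed
qed

section \<open>The generic flattening rank\<close>

lemma flattening_rank_le_minmono:
  assumes grown: "grown_tree W E" and "r \<ge> 1" and A: "A \<subseteq> leaves W E"
    and t: "t \<in> TNS W E d (\<lambda>e. r)"
  shows "flattening_rank d (leaves W E) A t \<le> r ^ minmono W E A"
proof -
  let ?L = "leaves W E"
  have fin: "finite ?L" using grown_tree_finite[OF grown] by (auto simp: leaves_def)
  obtain \<kappa> where \<kappa>: "\<And>l. l \<in> ?L \<Longrightarrow> \<kappa> l \<longleftrightarrow> l \<in> A"
    and card: "card {e \<in> E. bichromatic \<kappa> e} \<le> minmono W E A"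
    using minmono_colouring[OF grown A] by blast
  have "flattening_rank d ?L {l \<in> ?L. \<kappa> (id l)} t \<le> r ^ card {e \<in> E. bichromatic \<kappa> e}"
  proof (rule grown_tree_colouring_bound[OF _ _ _ grown, where \<rho> = "\<lambda>X. flattening_rank d ?L X t"])
    fix e u assume e: "e \<in> E" "u \<in> e"
    have "{l \<in> ?L. id l \<in> component_of (E - {e}) u} = component_of (E - {e}) u \<inter> ?L" by auto
    then show "flattening_rank d ?L {l \<in> ?L. id l \<in> component_of (E - {e}) u} t \<le> r"
      using t e by (simp add: TNS_def)
  next
    show "flattening_rank d ?L {} t \<le> 1" by (rule flattening_rank_empty_le)
    show "flattening_rank d ?L (?L - X) t = flattening_rank d ?L X t" if "X \<subseteq> ?L" for X
      by (rule flattening_rank_compl[OF fin that])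
    show "flattening_rank d ?L (X \<union> Y) t \<le> flattening_rank d ?L X t * flattening_rank d ?L Y t"
      if "X \<subseteq> ?L" "Y \<subseteq> ?L" "X \<inter> Y = {}" for X Y
      by (rule flattening_rank_Un_le[OF fin that])
  qed (simp add: leaves_def)
  moreover have "{l \<in> ?L. \<kappa> (id l)} = A" using \<kappa> A by auto
  moreover have "r ^ card {e \<in> E. bichromatic \<kappa> e} \<le> r ^ minmono W E A"
    using card assms(2) by (rule power_increasing)
  ultimately show ?thesis by simp
qed

text \<open>\<open>TNS\<close> bounds the rank on both sides of every edge, and these sides together
  are not laminar. Invariance under complements allows one side \<open>F e\<close> per edge to be
  kept.\<close>

lemma TNS_polynomial_path:
  assumes grown: "grown_tree W E"
    and t: "t\<^sub>0 \<in> TNS W E d (\<lambda>e. r)" "t\<^sub>1 \<in> TNS W E d (\<lambda>e. r)"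
  shows "\<exists>\<gamma>. (\<forall>i. poly_fun (\<lambda>s. \<gamma> s i)) \<and> \<gamma> 0 = t\<^sub>0 \<and> \<gamma> 1 = t\<^sub>1 \<and> (\<forall>s. \<gamma> s \<in> TNS W E d (\<lambda>e. r))"
proof -
  let ?L = "leaves W E"
  have fin: "finite W" "finite E" using grown_tree_finite[OF grown] by auto
  have L: "?L \<subseteq> W" "finite ?L" using fin by (auto simp: leaves_def)
  obtain F where F: "\<And>e. e \<in> E \<Longrightarrow> F e \<subseteq> W"
    "\<And>e u. e \<in> E \<Longrightarrow> u \<in> e \<Longrightarrow> component_of (E - {e}) u = F e \<or> component_of (E - {e}) u = W - F e"
    "\<And>e f. e \<in> E \<Longrightarrow> f \<in> E \<Longrightarrow> F e \<subseteq> F f \<or> F f \<subseteq> F e \<or> F e \<inter> F f = {}"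
    using grown_tree_laminar_sides[OF grown] by metis
  have rank: "flattening_rank d ?L (component_of (E - {e}) u \<inter> ?L) t = flattening_rank d ?L (F e \<inter> ?L) t"
    if "e \<in> E" "u \<in> e" for e u t
  proof -
    have "(W - F e) \<inter> ?L = ?L - F e \<inter> ?L" using L(1) by auto
    then show ?thesis using F(2)[OF that] flattening_rank_compl[OF L(2), of "F e \<inter> ?L" d t] by auto
  qed
  have TNS: "t \<in> TNS W E d (\<lambda>e. r) \<longleftrightarrow> t \<in> tensor_space d ?L \<and>
      (\<forall>B\<in>(\<lambda>e. F e \<inter> ?L) ` E. flattening_rank d ?L B t \<le> r)" for t
  proof -
    have "(\<forall>u\<in>e. flattening_rank d ?L (component_of (E - {e}) u \<inter> ?L) t \<le> r)
        \<longleftrightarrow> flattening_rank d ?L (F e \<inter> ?L) t \<le> r" if "e \<in> E" for e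
      using rank[OF that] grown_tree_edge[OF grown that] by auto
    then show ?thesis by (simp add: TNS_def)
  qed
  show ?thesis
    unfolding TNS
  proof (rule laminar_polynomial_path)
    fix B C assume "B \<in> (\<lambda>e. F e \<inter> ?L) ` E" "C \<in> (\<lambda>e. F e \<inter> ?L) ` E"
    then obtain e f where "e \<in> E" "f \<in> E" "B = F e \<inter> ?L" "C = F f \<inter> ?L" by auto
    then show "B \<subseteq> C \<or> C \<subseteq> B \<or> B \<inter> C = {}" using F(3)[of e f] by auto
  qed (use t fin L in \<open>auto simp: TNS\<close>)
qed

text \<open>Every factor of this tensor product has entries 0 and 1 only, so the product is the
  indicator of the index conditions. Indices start at 0, and unpaired leaves carry the basis vector
  with index 0.\<close>

definition pairing_tensor ::
  "('v \<Rightarrow> nat) \<Rightarrow> nat \<Rightarrow> 'v set \<Rightarrow> ('v \<times> 'v) set \<Rightarrow> 'v tensor" where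
  "pairing_tensor d r L M = (\<lambda>i. if i \<in> multi_index d L \<and>
     (\<forall>m\<in>M. i (fst m) = i (snd m) \<and> i (fst m) < r) \<and>
     (\<forall>l\<in>L - fst ` M - snd ` M. i l = 0) then 1 else 0)"

text \<open>Pairs on one side of \<open>B\<close> contribute a factor living on that side. By
  \<open>unique\<close> at most one pair is split, and it contributes a sum of \<open>r\<close>
  products.\<close>

lemma flattening_rank_pairing_tensor_le:
  assumes "B \<subseteq> L" and "r \<ge> 1" and M: "M \<subseteq> L \<times> L"
    and unique: "\<And>m m'. m \<in> M \<Longrightarrow> m' \<in> M \<Longrightarrow> (fst m \<in> B) \<noteq> (snd m \<in> B) \<Longrightarrow>
      (fst m' \<in> B) \<noteq> (snd m' \<in> B) \<Longrightarrow> m = m'"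
  shows "flattening_rank d L B (pairing_tensor d r L M) \<le> r"
proof -
  \<comment> \<open>What side \<open>D\<close> sees of a pair: the whole condition if both ends lie
    in \<open>D\<close>, and the prescribed common value \<open>s\<close> if only one end
    does.\<close>
  define H1 where "H1 s D i m \<longleftrightarrow>
      (fst m \<in> D \<longrightarrow> snd m \<in> D \<longrightarrow> i (fst m) = i (snd m) \<and> i (fst m) < r) \<and>
      (fst m \<in> D \<longrightarrow> snd m \<notin> D \<longrightarrow> i (fst m) = s) \<and> (fst m \<notin> D \<longrightarrow> snd m \<in> D \<longrightarrow> i (snd m) = s)"
    for s :: nat and D and i :: "'a \<Rightarrow> nat" and m
  define H where "H s D i \<longleftrightarrow> (\<forall>l\<in>D - fst ` M - snd ` M. i l = 0) \<and> (\<forall>m\<in>M. H1 s D i m)"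
    for s :: nat and D and i :: "'a \<Rightarrow> nat"
  define Q where "Q i \<longleftrightarrow> (\<forall>m\<in>M. i (fst m) = i (snd m) \<and> i (fst m) < r) \<and>
     (\<forall>l\<in>L - fst ` M - snd ` M. i l = 0)" for i :: "'a \<Rightarrow> nat"
  have dep: "depends_on D (\<lambda>i. of_bool (H s D i) :: complex)" for s D
  proof (rule depends_onI)
    fix i j :: "'a \<Rightarrow> nat" assume ij: "\<And>l. l \<in> D \<Longrightarrow> i l = j l"
    have "H s D i \<longleftrightarrow> H s D j"
      unfolding H_def H1_def using ij by (intro arg_cong2[of _ _ _ _ "(\<and>)"] ball_cong refl) auto
    then show "of_bool (H s D i) = (of_bool (H s D j) :: complex)" by simp
  qed
  have L: "fst m \<in> L" "snd m \<in> L" if "m \<in> M" for m using M that by auto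
  have outer: "(\<forall>l\<in>L - fst ` M - snd ` M. i l = 0) \<longleftrightarrow>
     (\<forall>l\<in>B - fst ` M - snd ` M. i l = 0) \<and> (\<forall>l\<in>(L - B) - fst ` M - snd ` M. i l = 0)" for i :: "'a \<Rightarrow> nat"
    using assms(1) by blast
  have HH: "H s B i \<and> H s (L - B) i \<longleftrightarrow> (\<forall>l\<in>L - fst ` M - snd ` M. i l = 0) \<and>
     (\<forall>m\<in>M. if (fst m \<in> B) = (snd m \<in> B) then i (fst m) = i (snd m) \<and> i (fst m) < r
        else i (fst m) = s \<and> i (snd m) = s)" for s and i :: "'a \<Rightarrow> nat"
  proof -
    have "H1 s B i m \<and> H1 s (L - B) i m \<longleftrightarrow>
        (if (fst m \<in> B) = (snd m \<in> B) then i (fst m) = i (snd m) \<and> i (fst m) < r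
         else i (fst m) = s \<and> i (snd m) = s)" if "m \<in> M" for m
      using L[OF that] by (auto simp: H1_def)
    then have "(\<forall>m\<in>M. H1 s B i m) \<and> (\<forall>m\<in>M. H1 s (L - B) i m) \<longleftrightarrow>
        (\<forall>m\<in>M. if (fst m \<in> B) = (snd m \<in> B) then i (fst m) = i (snd m) \<and> i (fst m) < r
         else i (fst m) = s \<and> i (snd m) = s)"
      unfolding ball_conj_distrib[symmetric] by (rule ball_cong[OF refl])
    then show ?thesis unfolding H_def outer by argo
  qed
  obtain I where I: "finite I" "card I \<le> r"
    "\<And>i. of_bool (Q i) = (\<Sum>s\<in>I. of_bool (H s B i) * of_bool (H s (L - B) i) :: complex)"
  proof (cases "\<exists>m\<in>M. (fst m \<in> B) \<noteq> (snd m \<in> B)")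
    case False
    then have "H 0 B i \<and> H 0 (L - B) i \<longleftrightarrow> Q i" for i
      unfolding HH Q_def by auto
    then have "of_bool (Q i) = (of_bool (H 0 B i) * of_bool (H 0 (L - B) i) :: complex)" for i
      by (simp flip: of_bool_conj)
    \<comment> \<open>Without a split pair the value \<open>s\<close> is irrelevant and a single
      product suffices; \<open>r \<ge> 1\<close> makes room for it.\<close>
    then show thesis using assms(2) by (intro that[of "{0}"]) auto
  next
    case True
    then obtain k where k: "k \<in> M" "(fst k \<in> B) \<noteq> (snd k \<in> B)" by blast
    \<comment> \<open>In the sum over \<open>s\<close> only the term matching the index at the split
      pair survives.\<close>
    have "H s B i \<and> H s (L - B) i \<longleftrightarrow> s = i (fst k) \<and> Q i" if "s < r" for s i
    proof -
      have "(if (fst m \<in> B) = (snd m \<in> B) then i (fst m) = i (snd m) \<and> i (fst m) < r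
             else i (fst m) = s \<and> i (snd m) = s)
        \<longleftrightarrow> (if m = k then i (fst m) = s \<and> i (snd m) = s else i (fst m) = i (snd m) \<and> i (fst m) < r)"
        if "m \<in> M" for m
      proof (cases "m = k")
        case False
        then have "(fst m \<in> B) = (snd m \<in> B)" using unique[OF k(1) that k(2)] by blast
        then show ?thesis using False by simp
      qed (use k(2) in simp)
      then have "H s B i \<and> H s (L - B) i \<longleftrightarrow> (\<forall>l\<in>L - fst ` M - snd ` M. i l = 0) \<and>
          (\<forall>m\<in>M. if m = k then i (fst m) = s \<and> i (snd m) = s
             else i (fst m) = i (snd m) \<and> i (fst m) < r)"
        unfolding HH by (intro arg_cong2[of _ _ _ _ "(\<and>)"] refl ball_cong)
      also have "\<dots> \<longleftrightarrow> s = i (fst k) \<and> Q i"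
        unfolding Q_def using k(1) \<open>s < r\<close> by auto
      finally show ?thesis .
    qed
    then have "(\<Sum>s<r. of_bool (H s B i) * of_bool (H s (L - B) i) :: complex)
        = (\<Sum>s<r. if s = i (fst k) then of_bool (Q i) else 0)" for i
      by (intro sum.cong) (auto simp flip: of_bool_conj)
    moreover have "(\<Sum>s<r. if s = i (fst k) then of_bool (Q i) else 0) = (of_bool (Q i) :: complex)" for i
      using k(1) by (auto simp: Q_def)
    ultimately show thesis by (intro that[of "{..<r}"]) simp_all
  qed
  have "flattening_rank d L B (pairing_tensor d r L M) \<le> card I"
    using I(1) assms(1) dep dep
  proof (rule flattening_rank_le_card)
    fix i assume "i \<in> multi_index d L"
    then show "pairing_tensor d r L M i = (\<Sum>s\<in>I. of_bool (H s B i) * of_bool (H s (L - B) i))"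
      unfolding I(3)[symmetric] by (auto simp: pairing_tensor_def Q_def)
  qed
  then show ?thesis using I(2) by linarith
qed

text \<open>Rows and columns are both labelled by the functions from \<open>M\<close> to
  \<open>{..<r}\<close>, one index value per pair. The entry is 1 exactly when the two labels agree
  at every pair, so the submatrix is the identity.\<close>

lemma pairing_tensor_minor:
  assumes "finite M" and A: "A \<subseteq> L" and M: "M \<subseteq> A \<times> (L - A)" "inj_on fst M" "inj_on snd M"
    and r: "r \<ge> 1" "\<And>l. l \<in> L \<Longrightarrow> r \<le> d l"
  obtains x y where "\<And>a. a < r ^ card M \<Longrightarrow> x a \<in> multi_index d A"
    and "\<And>b. b < r ^ card M \<Longrightarrow> y b \<in> multi_index d (L - A)"
    and "flattening_minor A (r ^ card M) x y (pairing_tensor d r L M) \<noteq> 0"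
proof -
  define S where "S = (\<Pi>\<^sub>E m\<in>M. {..<r})"
  have "finite S" "card S = r ^ card M"
    using assms(1) by (auto simp: S_def card_PiE intro!: finite_PiE)
  then obtain h where h: "bij_betw h {..<r ^ card M} S"
    using ex_bij_betw_nat_finite[of S] by (auto simp: atLeast0LessThan)
  then have hS: "h a \<in> S" if "a < r ^ card M" for a using that bij_betwE by blast
  have h_less: "h a m < r" if "a < r ^ card M" "m \<in> M" for a m
    using hS[OF that(1)] that(2) by (auto simp: S_def PiE_iff)
  \<comment> \<open>The label \<open>h a\<close> is written on the ends of the pairs in
    \<open>A\<close>, and \<open>h b\<close> on the opposite ends; unpaired leaves get the index 0
    that \<open>pairing_tensor\<close> demands.\<close>
  define x where "x a = restrict (\<lambda>l. if l \<in> fst ` M then h a (inv_into M fst l) else 0) A" for a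
  define y where "y b = restrict (\<lambda>l. if l \<in> snd ` M then h b (inv_into M snd l) else 0) (L - A)" for b
  have less_d: "h a m < d l" if "a < r ^ card M" "m \<in> M" "l \<in> L" for a m l
    using h_less[OF that(1,2)] r(2)[OF that(3)] by linarith
  have entry: "(if l \<in> f ` M then h a (inv_into M f l) else 0) < d l"
    if "a < r ^ card M" "l \<in> L" for a l and f :: "'a \<times> 'a \<Rightarrow> 'a"
    using less_d[OF that(1) inv_into_into that(2)] r(1) r(2)[OF that(2)]
    by (cases "l \<in> f ` M") simp_all
  show thesis
  proof (rule that)
    show x: "x a \<in> multi_index d A" if "a < r ^ card M" for a
      unfolding x_def multi_index_def restrict_PiE_iff
      using entry[OF that] A by (simp add: subset_iff)
    show y: "y b \<in> multi_index d (L - A)" if "b < r ^ card M" for b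
      unfolding y_def multi_index_def restrict_PiE_iff
      using entry[OF that] by simp
    have "pairing_tensor d r L M (override_on (y b) (x a) A) = (if a = b then 1 else 0)"
      if ab: "a < r ^ card M" "b < r ^ card M" for a b
    proof -
      let ?i = "override_on (y b) (x a) A"
      have i: "?i \<in> multi_index d L" using x[OF ab(1)] y[OF ab(2)] A by (intro multi_index_override)
      have M_val: "?i (fst m) = h a m" "?i (snd m) = h b m" if "m \<in> M" for m
        using M that by (auto simp: x_def y_def override_on_def inv_into_f_f)
      have "?i l = 0" if "l \<in> L - fst ` M - snd ` M" for l
        using that by (auto simp: x_def y_def override_on_def)
      then have "pairing_tensor d r L M ?i = (if \<forall>m\<in>M. h a m = h b m then 1 else 0)"
        using i M_val h_less[OF ab(1)] by (simp add: pairing_tensor_def)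
      moreover have "(\<forall>m\<in>M. h a m = h b m) \<longleftrightarrow> h a = h b"
        using hS[OF ab(1)] hS[OF ab(2)] unfolding S_def by (metis PiE_ext)
      moreover have "h a = h b \<longleftrightarrow> a = b"
        using h ab by (auto simp: bij_betw_def dest: inj_onD)
      ultimately show ?thesis by simp
    qed
    then have "mat (r ^ card M) (r ^ card M) (\<lambda>(a, b). pairing_tensor d r L M (override_on (y b) (x a) A))
        = 1\<^sub>m (r ^ card M)"
      by (intro eq_matI) auto
    then show "flattening_minor A (r ^ card M) x y (pairing_tensor d r L M) \<noteq> 0"
      by (simp add: flattening_minor_def)
  qed
qed

theorem mainTheorem3:
  fixes W :: "'v set" and E :: "'v set set"
    and d :: "'v \<Rightarrow> nat" and r :: nat and A :: "'v set"
  assumes "binary_tree W E"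
    and "r \<ge> 1"
    and "\<forall>l\<in>leaves W E. d l \<ge> r"
    and "A \<subseteq> leaves W E"
  shows "generically (tensor_space d (leaves W E)) (TNS W E d (\<lambda>e. r))
           (\<lambda>t. flattening_rank d (leaves W E) A t = r ^ minmono W E A)"
proof -
  let ?L = "leaves W E"
  have grown: "grown_tree W E"
    using assms(1) unfolding binary_tree_def by (blast intro: unrooted_tree_grown)
  have fin: "finite W" "finite E" using grown_tree_finite[OF grown] by auto
  have L: "?L \<subseteq> W" "finite ?L" using fin by (auto simp: leaves_def)
  have finA: "finite A" using assms(4) L(2) by (rule finite_subset)
  have "id ` (A \<union> (?L - A)) \<subseteq> W" using L assms(4) by auto
  then obtain M \<kappa> where mf: "max_flow_min_cut E A (?L - A) id M \<kappa>"
    using grown_tree_max_flow_min_cut[OF grown finA, of "?L - A" id] L(2) by auto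
  then have M: "M \<subseteq> A \<times> (?L - A)" "inj_on fst M" "inj_on snd M"
    and card: "minmono W E A \<le> card M"
    using minmono_le_colouring[OF grown assms(4), of \<kappa>] unfolding max_flow_min_cut_def by simp_all
  have sep: "m = m'" if "e \<in> E" "m \<in> M" "m' \<in> M" "snd m \<notin> component_of (E - {e}) (fst m)"
    "snd m' \<notin> component_of (E - {e}) (fst m')" for e m m'
  proof -
    have "\<forall>e\<in>E. \<forall>m\<in>M. \<forall>m'\<in>M. snd m \<notin> component_of (E - {e}) (fst m) \<longrightarrow>
        snd m' \<notin> component_of (E - {e}) (fst m') \<longrightarrow> m = m'"
      using mf unfolding max_flow_min_cut_def id_apply by (elim conjE)
    then show ?thesis using that by metis
  qed
  have finM: "finite M" using M(1) finA L(2) by (auto intro: finite_subset)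
  define T where "T = pairing_tensor d r ?L M"
  obtain x y where x: "\<And>a. a < r ^ card M \<Longrightarrow> x a \<in> multi_index d A"
    and y: "\<And>b. b < r ^ card M \<Longrightarrow> y b \<in> multi_index d (?L - A)"
    and minor: "flattening_minor A (r ^ card M) x y T \<noteq> 0"
    unfolding T_def
    by (rule pairing_tensor_minor[OF finM assms(4) M assms(2), of d]) (use assms(3) in auto)
  have T: "T \<in> TNS W E d (\<lambda>e. r)"
    unfolding TNS_def
  proof (intro CollectI conjI ballI)
    show "T \<in> tensor_space d ?L" by (auto simp: T_def pairing_tensor_def tensor_space_def)
    fix e u assume e: "e \<in> E" "u \<in> e"
    show "flattening_rank d ?L (component_of (E - {e}) u \<inter> ?L) T \<le> r"
      unfolding T_def
    proof (rule flattening_rank_pairing_tensor_le)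
      \<comment> \<open>A pair with exactly one end in the component is separated by
        \<open>e\<close>, so edge-disjointness of the paths gives the uniqueness of the split
        pair.\<close>
      have split: "snd m \<notin> component_of (E - {e}) (fst m)"
        if m: "m \<in> M" "(fst m \<in> component_of (E - {e}) u \<inter> ?L) \<noteq> (snd m \<in> component_of (E - {e}) u \<inter> ?L)"
        for m
      proof
        assume s: "snd m \<in> component_of (E - {e}) (fst m)"
        have "fst m \<in> ?L" "snd m \<in> ?L" using subsetD[OF M(1) m(1)] assms(4) by (auto simp: mem_Times_iff)
        then show False using m(2) s component_of_trans component_of_sym by (metis IntI IntD1)
      qed
      show "m = m'" if "m \<in> M" "m' \<in> M"
        "(fst m \<in> component_of (E - {e}) u \<inter> ?L) \<noteq> (snd m \<in> component_of (E - {e}) u \<inter> ?L)"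
        "(fst m' \<in> component_of (E - {e}) u \<inter> ?L) \<noteq> (snd m' \<in> component_of (E - {e}) u \<inter> ?L)" for m m'
        using sep[OF e(1) that(1,2)] split that by blast
    qed (use assms(2,4) M(1) in auto)
  qed
  show ?thesis
  proof (rule generically_polynomial_path)
    show "TNS W E d (\<lambda>e. r) \<subseteq> tensor_space d ?L" by (auto simp: TNS_def)
    show "flattening_minor A (r ^ card M) x y \<in> polynomial_functions"
      by (rule flattening_minor_polynomial)
    show "T \<in> TNS W E d (\<lambda>e. r)" "flattening_minor A (r ^ card M) x y T \<noteq> 0" by (fact T minor)+
    fix t assume t: "t \<in> TNS W E d (\<lambda>e. r)"
    show "\<exists>\<gamma>. (\<forall>i. poly_fun (\<lambda>s. \<gamma> s i)) \<and> \<gamma> 0 = t \<and> \<gamma> 1 = T \<and> (\<forall>s. \<gamma> s \<in> TNS W E d (\<lambda>e. r))"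
      by (rule TNS_polynomial_path[OF grown t T])
    assume "flattening_minor A (r ^ card M) x y t \<noteq> 0"
    then have "r ^ card M \<le> flattening_rank d ?L A t"
      by (intro flattening_rank_ge_minor[OF L(2) assms(4) x y])
    \<comment> \<open>Only \<open>minmono W E A \<le> card M\<close> is available; the upper bound
      on the rank closes the gap.\<close>
    moreover have "r ^ minmono W E A \<le> r ^ card M" using card assms(2) by (rule power_increasing)
    moreover have "flattening_rank d ?L A t \<le> r ^ minmono W E A"
      by (rule flattening_rank_le_minmono[OF grown assms(2,4) t])
    ultimately show "flattening_rank d ?L A t = r ^ minmono W E A" by linarith
  qed
qed

end
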